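(* Let $\mathcal{A}=\{A_1,\dots,A_m\}$ be a finite irreducible family of nonnegative $d\times d$ matrices with probabilities $p_1,\dots,p_m$, such that no matrix of $\mathcal{A}$ has a zero row or a zero column. Suppose that there is a partition of $\Omega=\{1,\dots,d\}$ into $r\ge2$ nonempty sets $\Omega_1,\dots,\Omega_r$ on which every matrix from $\mathcal{A}$ acts as a permutation, and that there is a product $D$ of matrices from $\mathcal{A}$ which has block-diagonal form with $r$ strictly positive diagonal blocks corresponding to the sets $\Omega_1,\dots,\Omega_r$. Let $\lambda$ be the Lyapunov exponent of $\mathcal{A}$. Then for all vectors $x,v\in\mathbb{R}^d$ with strictly positive entries we have $$\beta_k(v)\ \le\ \lambda\ \le\ \tilde\alpha_k(x)\qquad\text{for all }k\in\mathbb{N},$$ and there is a constant $C$ depending on $\mathcal{A}$, $x$ and $v$ such that $$\tilde\alpha_k(x)-\beta_k(v)\ \le\ C\,k^{-1}\qquad\text{for all }k\in\mathbb{N}.$$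
   Context: $p_j>0$, $\sum_{j=1}^m p_j=1$. For $k\in\mathbb{N}$ ($k\ge1$), $\mathcal{A}^k$ is the family of all $m^k$ products of length $k$ with the product probabilities, and $\mathbf{E}\{g(B)\mid B\in\mathcal{A}^k\}=\sum_{d_1,\dots,d_k}p_{d_1}\cdots p_{d_k}\,g(A_{d_k}\cdots A_{d_1})$. The Lyapunov exponent is $\lambda=\lim_{k\to\infty}\frac1k\mathbf{E}\{\log\|B\|\mid B\in\mathcal{A}^k\}$. The family $\mathcal{A}$ is reducible if there is a nontrivial subspace of $\mathbb{R}^d$ (different from $\{0\}$ and $\mathbb{R}^d$) spanned by several vectors of the canonical basis $e_1,\dots,e_d$ that is invariant for all matrices from $\mathcal{A}$; otherwise it is irreducible. A matrix $A$ acts as a permutation on the partition $\Omega_1,\dots,\Omega_r$ if there is a permutation $\sigma$ of $\{1,\dots,r\}$ with $AL_n\subset L_{\sigma(n)}$ for $n=1,\dots,r$, where $L_n=\{\sum_{i\in\Omega_n}t_ie_i\mid t_i\ge0\}$. For $x,v$ with strictly positive entries: $$\tilde\alpha_k(x)=\frac1k\max_{j=1,\dots,r}\mathbf{E}\Bigl\{\max_{i\in\Omega_j}\log\frac{(Bx)_i}{x_i}\ \Big|\ B\in\mathcal{A}^k\Bigr\},$$ $$\beta_k(v)=\frac1k\min_{j=1,\dots,d}\Bigl(-\log v_j+\mathbf{E}\bigl\{\log (v,b^j)\mid B\in\mathcal{A}^k\bigr\}\Bigr),$$ where $b^j$ denotes the $j$th column of $B$ and $(\cdot,\cdot)$ is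 the standard inner product. *)

theory Defs
  imports "HOL-Analysis.Analysis"
begin

text \<open>
  A family \<open>A\<^sub>1, \<dots>, A\<^sub>m\<close> with probabilities \<open>p\<^sub>1, \<dots>, p\<^sub>m\<close> is given by functions on \<open>nat\<close>
  that are only used on the index set \<open>{1..m}\<close>.
\<close>

type_synonym 'n family = "nat \<Rightarrow> real ^ 'n ^ 'n"

definition words :: "nat \<Rightarrow> nat \<Rightarrow> nat list set" where
  "words m k = {ds. set ds \<subseteq> {1..m} \<and> length ds = k}"

text \<open>The first letter is the rightmost factor: \<open>[d\<^sub>1, \<dots>, d\<^sub>k]\<close> gives \<open>A d\<^sub>k ** \<dots> ** A d\<^sub>1\<close>.\<close>

primrec word_prod :: "('n::finite) family \<Rightarrow> nat list \<Rightarrow> real ^ 'n ^ 'n" where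
  "word_prod A [] = mat 1"
| "word_prod A (d # ds) = word_prod A ds ** A d"

definition expect ::
  "nat \<Rightarrow> (nat \<Rightarrow> real) \<Rightarrow> ('n::finite) family \<Rightarrow> nat \<Rightarrow> (real ^ 'n ^ 'n \<Rightarrow> real) \<Rightarrow> real" where
  "expect m p A k g = (\<Sum>ds\<in>words m k. prod_list (map p ds) * g (word_prod A ds))"

text \<open>
  The matrix norm is the operator norm of the Euclidean norm; all matrix norms give the same
  limit. The term for \<open>k = 0\<close> is irrelevant.
\<close>

definition lyapunov_exponent ::
  "nat \<Rightarrow> (nat \<Rightarrow> real) \<Rightarrow> ('n::finite) family \<Rightarrow> real" where
  "lyapunov_exponent m p A =
     lim (\<lambda>k. (1 / real k) * expect m p A k (\<lambda>B. ln (onorm ((*v) B))))"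

definition coord_subspace :: "('n::finite) set \<Rightarrow> (real ^ 'n) set" where
  "coord_subspace S = span ((\<lambda>i. axis i 1) ` S)"

definition reducible_family :: "nat \<Rightarrow> ('n::finite) family \<Rightarrow> bool" where
  "reducible_family m A \<longleftrightarrow>
     (\<exists>S. coord_subspace S \<noteq> {0} \<and> coord_subspace S \<noteq> UNIV \<and>
        (\<forall>j\<in>{1..m}. \<forall>u\<in>coord_subspace S. A j *v u \<in> coord_subspace S))"

definition indexed_partition :: "nat \<Rightarrow> (nat \<Rightarrow> 'n set) \<Rightarrow> bool" where
  "indexed_partition r \<Omega> \<longleftrightarrow>
     (\<forall>n\<in>{1..r}. \<Omega> n \<noteq> {}) \<and> disjoint_family_on \<Omega> {1..r} \<and> (\<Union>n\<in>{1..r}. \<Omega> n) = UNIV"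

definition coord_cone :: "('n::finite) set \<Rightarrow> (real ^ 'n) set" where
  "coord_cone S = {(\<Sum>i\<in>S. t i *\<^sub>R axis i 1) | t. \<forall>i\<in>S. t i \<ge> 0}"

definition acts_as_permutation ::
  "nat \<Rightarrow> (nat \<Rightarrow> ('n::finite) set) \<Rightarrow> real ^ 'n ^ 'n \<Rightarrow> bool" where
  "acts_as_permutation r \<Omega> M \<longleftrightarrow>
     (\<exists>\<sigma>. \<sigma> permutes {1..r} \<and>
        (\<forall>n\<in>{1..r}. (*v) M ` coord_cone (\<Omega> n) \<subseteq> coord_cone (\<Omega> (\<sigma> n))))"

definition positive_block_diagonal ::
  "nat \<Rightarrow> (nat \<Rightarrow> ('n::finite) set) \<Rightarrow> real ^ 'n ^ 'n \<Rightarrow> bool" where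
  "positive_block_diagonal r \<Omega> M \<longleftrightarrow>
     (\<forall>n\<in>{1..r}. \<forall>l\<in>{1..r}. \<forall>i\<in>\<Omega> n. \<forall>j\<in>\<Omega> l.
        (if n = l then M $ i $ j > 0 else M $ i $ j = 0))"

definition alpha_tilde ::
  "nat \<Rightarrow> (nat \<Rightarrow> real) \<Rightarrow> ('n::finite) family \<Rightarrow> nat \<Rightarrow> (nat \<Rightarrow> 'n set) \<Rightarrow> nat \<Rightarrow> real ^ 'n \<Rightarrow> real"
  where
  "alpha_tilde m p A r \<Omega> k x =
     (1 / real k) *
       (MAX j\<in>{1..r}. expect m p A k (\<lambda>B. MAX i\<in>\<Omega> j. ln ((B *v x) $ i / x $ i)))"

definition beta ::
  "nat \<Rightarrow> (nat \<Rightarrow> real) \<Rightarrow> ('n::finite) family \<Rightarrow> nat \<Rightarrow> real ^ 'n \<Rightarrow> real" where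
  "beta m p A k v =
     (1 / real k) *
       (MIN j\<in>UNIV. - ln (v $ j) + expect m p A k (\<lambda>B. ln (v \<bullet> column j B)))"

end

theory Submission
  imports Defs
begin

text \<open>
  Let \<open>f\<^sub>k(y) = E log (v, B y)\<close> and let \<open>g\<^sub>k = k \<beta>\<^sub>k(v)\<close>. Concavity of the logarithm gives
  \<open>f\<^sub>k(y) \<ge> log (v, y) + g\<^sub>k\<close>. Conversely, if a word \<open>W\<close> satisfies \<open>W e\<^sub>c \<ge> y\<close>, then conditioning on the
  first letters shows that \<open>f\<^sub>k(e\<^sub>c)\<close> is, up to a constant, at least a convex combination of \<open>f\<^sub>k(y)\<close> and
  \<open>g\<^sub>k\<close> with fixed weights; so if \<open>f\<^sub>k(e\<^sub>c) - g\<^sub>k\<close> is bounded above, so is \<open>f\<^sub>k(y) - g\<^sub>k\<close>. Starting from a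
  minimizing column, this minimum principle spreads along the edges of the irreducible family to all
  columns, and by the block-positive product to all \<open>y\<close> supported in one block. Hence
  \<open>f\<^sub>k(y) = log (v, y) + g\<^sub>k + O(1)\<close> for such \<open>y\<close>, and \<open>g\<^sub>k = k L + O(1)\<close>.

  The row quantities inside \<open>\<alpha>\<^sub>k\<close> obey the analogous maximum principle, so they agree up to \<open>O(1)\<close> for
  all blocks; summing over the blocks, which each matrix merely permutes, identifies them with
  \<open>k L + O(1)\<close>. Finally \<open>log (v, B y) - k L\<close> is a martingale with bounded increments up to a bounded
  error, so its second moment is \<open>O(k)\<close>; thus the maximum of \<open>log (v, B e\<^sub>c)\<close> over all columns has mean
  \<open>k L + O(\<surd>k)\<close>, and \<open>L\<close> is the Lyapunov exponent.
\<close>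

section \<open>Semipositive vectors and strictly positive functionals\<close>

definition semipositive :: "real ^ 'n \<Rightarrow> bool" where
  "semipositive z \<longleftrightarrow> (\<forall>i. 0 \<le> z $ i) \<and> z \<noteq> 0"

lemma semipositive_nonneg: "semipositive z \<Longrightarrow> 0 \<le> z $ i"
  by (simp add: semipositive_def)

lemma semipositive_obtain:
  assumes "semipositive z"
  obtains i where "0 < z $ i"
  using assms by (auto simp: semipositive_def vec_eq_iff less_le)

lemma semipositiveI: "(\<And>i. 0 \<le> z $ i) \<Longrightarrow> 0 < z $ j \<Longrightarrow> semipositive z"
  by (auto simp: semipositive_def)

lemma semipositive_axis: "semipositive (axis c (1::real))"
  by (rule semipositiveI[of _ c]) (auto simp: axis_def)

lemma inner_semipositive_pos:
  fixes a z :: "real ^ 'n::finite"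
  assumes a: "\<And>i. 0 < a $ i" and z: "semipositive z"
  shows "0 < a \<bullet> z"
proof -
  obtain j where j: "0 < z $ j" using z by (rule semipositive_obtain)
  have "(\<Sum>i\<in>UNIV. a $ i * z $ i) > 0"
    by (rule sum_pos2[of _ j])
      (auto simp: j intro!: mult_pos_pos mult_nonneg_nonneg a less_imp_le[OF a] semipositive_nonneg[OF z])
  then show ?thesis by (simp add: inner_vec_def)
qed

lemma inner_mono_semipositive:
  fixes a b z :: "real ^ 'n::finite"
  assumes "\<And>i. a $ i \<le> b $ i" and "\<And>i. 0 \<le> z $ i"
  shows "a \<bullet> z \<le> b \<bullet> z"
  unfolding inner_vec_def using assms by (auto intro!: sum_mono mult_right_mono)

text \<open>A coordinatewise bound \<open>a $ i \<le> exp K * b $ i\<close> passes to the pairing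
  with every semipositive \<open>z\<close>, so \<open>K\<close> is uniform in \<open>z\<close>. This
  allows one positive weight to be exchanged for another at bounded logarithmic cost.\<close>

lemma ln_inner_comparable:
  fixes a b :: "real ^ 'n::finite"
  assumes a: "\<And>i. 0 < a $ i" and b: "\<And>i. 0 < b $ i"
  obtains K where "0 \<le> K" and "\<And>z. semipositive z \<Longrightarrow> \<bar>ln (a \<bullet> z) - ln (b \<bullet> z)\<bar> \<le> K"
proof -
  define K where "K = Max (range (\<lambda>i. \<bar>ln (a $ i) - ln (b $ i)\<bar>))"
  have K: "\<bar>ln (a $ i) - ln (b $ i)\<bar> \<le> K" for i
    unfolding K_def by (rule Max_ge) auto
  \<comment> \<open>\<open>a\<close>, \<open>b\<close> and \<open>z\<close> are bound afresh so that
    the estimate can be applied a second time with the two weights exchanged.\<close>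
  have one_sided: "ln (a \<bullet> z) \<le> K + ln (b \<bullet> z)"
    if z: "semipositive z" and ab: "\<And>i. ln (a $ i) \<le> K + ln (b $ i)"
      and a: "\<And>i. 0 < a $ i" and b: "\<And>i. 0 < b $ i" for a b z :: "real ^ 'n"
  proof -
    have "a $ i \<le> exp K * b $ i" for i
    proof -
      have "exp (ln (a $ i)) \<le> exp (K + ln (b $ i))" using ab by simp
      then show ?thesis by (simp add: exp_add a b)
    qed
    then have "a \<bullet> z \<le> (exp K *\<^sub>R b) \<bullet> z"
      by (intro inner_mono_semipositive) (auto simp: semipositive_nonneg[OF z])
    then have "a \<bullet> z \<le> exp K * (b \<bullet> z)" by simp
    then have "ln (a \<bullet> z) \<le> ln (exp K * (b \<bullet> z))"
      using inner_semipositive_pos[OF a z] by simp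
    also have "\<dots> = K + ln (b \<bullet> z)"
      using inner_semipositive_pos[OF b z] by (simp add: ln_mult)
    finally show ?thesis .
  qed
  show thesis
  proof (rule that)
    show "0 \<le> K" using K[of undefined] by linarith
    fix z :: "real ^ 'n" assume z: "semipositive z"
    have "ln (a \<bullet> z) \<le> K + ln (b \<bullet> z)"
    proof (rule one_sided[OF z _ a b])
      show "ln (a $ i) \<le> K + ln (b $ i)" for i using K[of i] by linarith
    qed
    moreover have "ln (b \<bullet> z) \<le> K + ln (a \<bullet> z)"
    proof (rule one_sided[OF z _ b a])
      show "ln (b $ i) \<le> K + ln (a $ i)" for i using K[of i] by linarith
    qed
    ultimately show "\<bar>ln (a \<bullet> z) - ln (b \<bullet> z)\<bar> \<le> K" by linarith
  qed
qed

section \<open>Components and supports of matrix products\<close>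

lemma matrix_vector_component: "(B *v z) $ i = row i B \<bullet> z"
  by (simp add: matrix_vector_mult_def row_def inner_vec_def)

lemma inner_matrix_vector: "v \<bullet> (B *v z) = (v v* B) \<bullet> z" for B :: "real ^ 'n::finite ^ 'n"
  by (simp add: dot_lmul_matrix)

lemma vector_matrix_component: "(v v* B) $ c = v \<bullet> column c B"
  by (simp add: vector_matrix_mult_def column_def inner_vec_def mult.commute)

lemma matrix_mult_nonzeroE:
  fixes B C :: "real ^ 'n::finite ^ 'n"
  assumes "(B ** C) $ i $ c \<noteq> 0"
  obtains j where "B $ i $ j \<noteq> 0" "C $ j $ c \<noteq> 0"
proof (rule ccontr)
  assume "\<not> thesis"
  then have "B $ i $ j * C $ j $ c = 0" for j using that by auto
  then have "(\<Sum>j\<in>UNIV. B $ i $ j * C $ j $ c) = 0" by (intro sum.neutral) simp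
  then show False using assms by (simp add: matrix_matrix_mult_def)
qed

lemma matrix_vector_nonzeroE:
  fixes B :: "real ^ 'n::finite ^ 'n"
  assumes "(B *v y) $ i \<noteq> 0"
  obtains c where "B $ i $ c \<noteq> 0" "y $ c \<noteq> 0"
proof (rule ccontr)
  assume "\<not> thesis"
  then have "B $ i $ c * y $ c = 0" for c using that by auto
  then have "(\<Sum>c\<in>UNIV. B $ i $ c * y $ c) = 0" by (intro sum.neutral) simp
  then show False using assms by (simp add: matrix_vector_mult_def)
qed

text \<open>Jensen's inequality for the logarithm, from the tangent at the weighted mean
  \<open>T\<close>: averaging \<open>ln T + t i / T - 1\<close> leaves \<open>ln T\<close>, since
  the weighted mean of \<open>t i / T\<close> is 1.\<close>

lemma weighted_sum_ln_le:
  fixes w t :: "'a \<Rightarrow> real"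
  assumes "finite I" and w: "\<And>i. i \<in> I \<Longrightarrow> 0 \<le> w i" and sum_w: "sum w I = 1"
    and t: "\<And>i. i \<in> I \<Longrightarrow> 0 < t i"
  shows "(\<Sum>i\<in>I. w i * ln (t i)) \<le> ln (\<Sum>i\<in>I. w i * t i)"
proof -
  define T where "T = (\<Sum>i\<in>I. w i * t i)"
  obtain j where j: "j \<in> I" "w j \<noteq> 0" using sum_w by (metis sum.neutral zero_neq_one)
  have T: "0 < T" unfolding T_def
  proof (rule sum_pos2[of _ j])
    show "0 < w j * t j" using j w[of j] t[of j] by (intro mult_pos_pos) auto
    show "0 \<le> w i * t i" if "i \<in> I" for i
      using that by (intro mult_nonneg_nonneg less_imp_le[OF t] w)
  qed (use assms j in auto)
  have "w i * ln (t i) \<le> w i * (ln T + t i / T - 1)" if i: "i \<in> I" for i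
  proof (rule mult_left_mono)
    have "ln (t i / T) \<le> t i / T - 1" by (rule ln_le_minus_one) (use t[OF i] T in simp)
    then show "ln (t i) \<le> ln T + t i / T - 1" using t[OF i] T by (simp add: ln_div)
  qed (rule w[OF i])
  then have "(\<Sum>i\<in>I. w i * ln (t i)) \<le> (\<Sum>i\<in>I. w i * (ln T + t i / T - 1))"
    by (rule sum_mono)
  also have "\<dots> = (\<Sum>i\<in>I. w i * (ln T - 1) + w i * t i / T)"
    by (intro sum.cong) (auto simp: algebra_simps)
  also have "\<dots> = sum w I * (ln T - 1) + T / T"
    by (simp add: sum.distrib sum_distrib_right T_def flip: sum_divide_distrib)
  also have "\<dots> = ln T" using T by (simp add: sum_w)
  finally show ?thesis by (simp add: T_def)
qed

section \<open>Words and expectations over random products\<close>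

lemma finite_words: "finite (words m k)"
  unfolding words_def by (rule finite_lists_length_eq) simp

lemma words_0: "words m 0 = {[]}"
  by (auto simp: words_def)

lemma words_Suc: "words m (Suc k) = (\<lambda>(d, ds). d # ds) ` ({1..m} \<times> words m k)"
proof
  show "words m (Suc k) \<subseteq> (\<lambda>(d, ds). d # ds) ` ({1..m} \<times> words m k)"
  proof
    fix w assume w: "w \<in> words m (Suc k)"
    then obtain d ds where "w = d # ds" by (auto simp: words_def length_Suc_conv)
    with w show "w \<in> (\<lambda>(d, ds). d # ds) ` ({1..m} \<times> words m k)"
      by (intro image_eqI[of _ _ "(d, ds)"]) (auto simp: words_def)
  qed
qed (auto simp: words_def)

lemma expect_0: "expect m p A 0 g = g (mat 1)"
  by (simp add: expect_def words_0)

text \<open>The first letter is the rightmost factor, so conditioning on it multiplies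
  \<open>B\<close> on the right.\<close>

lemma expect_Suc: "expect m p A (Suc k) g = (\<Sum>d=1..m. p d * expect m p A k (\<lambda>B. g (B ** A d)))"
proof -
  have "inj_on (\<lambda>(d, ds). d # ds) ({1..m} \<times> words m k)" by (auto simp: inj_on_def)
  then show ?thesis
    by (simp add: expect_def words_Suc sum.reindex sum.cartesian_product' sum_distrib_left mult.assoc
        case_prod_unfold)
qed

lemma expect_1: "expect m p A 1 g = (\<Sum>d=1..m. p d * g (A d))"
  by (simp add: expect_Suc expect_0)

lemma expect_add: "expect m p A k (\<lambda>B. g B + h B) = expect m p A k g + expect m p A k h"
  by (simp add: expect_def algebra_simps sum.distrib)

lemma expect_cmult: "expect m p A k (\<lambda>B. c * g B) = c * expect m p A k g"
  by (simp add: expect_def algebra_simps sum_distrib_left)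

lemma expect_diff: "expect m p A k (\<lambda>B. g B - h B) = expect m p A k g - expect m p A k h"
  by (simp add: expect_def algebra_simps sum_subtractf)

lemma expect_sum: "expect m p A k (\<lambda>B. \<Sum>i\<in>I. g i B) = (\<Sum>i\<in>I. expect m p A k (g i))"
  unfolding expect_def sum_distrib_left by (rule sum.swap)

text \<open>The first \<open>l\<close> letters form the right factor \<open>W\<close> and are
  independent of the remaining \<open>k\<close>.\<close>

lemma expect_append:
  "expect m p A (l + k) g = expect m p A l (\<lambda>W. expect m p A k (\<lambda>B. g (B ** W)))"
proof (induction l arbitrary: g)
  case 0
  then show ?case by (simp add: expect_0)
next
  case (Suc l)
  have "expect m p A (Suc l + k) g
      = (\<Sum>d=1..m. p d * expect m p A (l + k) (\<lambda>B. g (B ** A d)))"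
    by (simp add: expect_Suc)
  also have "\<dots> = expect m p A (Suc l) (\<lambda>W. expect m p A k (\<lambda>B. g (B ** W)))"
    by (simp add: Suc.IH expect_Suc matrix_mul_assoc)
  finally show ?case .
qed

text \<open>Together with \<open>expect_append\<close> this allows conditioning on the left factor,
  made of the last letters, which is what the row quantities require.\<close>

lemma expect_swap:
  "expect m p A l (\<lambda>W. expect m p A k (\<lambda>B. h W B))
    = expect m p A k (\<lambda>B. expect m p A l (\<lambda>W. h W B))"
  unfolding expect_def sum_distrib_left
  by (subst sum.swap) (simp add: algebra_simps)

section \<open>Almost additive sequences and propagation of minima\<close>

lemma superadditive_multiple:
  fixes g :: "nat \<Rightarrow> real"
  assumes "\<And>k l. g k + g l \<le> g (k + l)" and "n \<ge> 1"
  shows "real n * g k \<le> g (n * k)"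
  using assms(2)
proof (induction n rule: dec_induct)
  case (step n)
  then show ?case using assms(1)[of k "n * k"] by (simp add: algebra_simps)
qed simp

lemma subadditive_multiple:
  fixes g :: "nat \<Rightarrow> real"
  assumes "\<And>k l. g (k + l) \<le> g k + g l" and "n \<ge> 1"
  shows "g (n * k) \<le> real n * g k"
  using assms(2)
proof (induction n rule: dec_induct)
  case (step n)
  then show ?case using assms(1)[of k "n * k"] by (simp add: algebra_simps)
qed simp

text \<open>A quantitative form of Fekete's lemma: superadditivity bounds \<open>g\<close> by its
  slope without any error, and subadditivity up to \<open>C\<close> keeps it within \<open>C\<close>
  of the linear function.\<close>

lemma almost_additive_slope:
  fixes g :: "nat \<Rightarrow> real"
  assumes super: "\<And>k l. g k + g l \<le> g (k + l)" and sub: "\<And>k l. g (k + l) \<le> g k + g l + C"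
  obtains L where "\<And>k. k \<ge> 1 \<Longrightarrow> g k \<le> real k * L" and "\<And>k. k \<ge> 1 \<Longrightarrow> real k * L \<le> g k + C"
proof -
  \<comment> \<open>Both sides are compared with \<open>g (j * k)\<close>: from below by
    superadditivity of \<open>g\<close>, from above by subadditivity of
    \<open>\<lambda>k. g k + C\<close>.\<close>
  have cross: "real k * g j \<le> real j * (g k + C)" if "j \<ge> 1" "k \<ge> 1" for j k
  proof -
    have "real k * g j \<le> g (k * j)" by (rule superadditive_multiple[OF super]) (use that in auto)
    moreover have "g (j * k) + C \<le> real j * (g k + C)"
      using subadditive_multiple[of "\<lambda>k. g k + C" j k] sub that by (simp add: algebra_simps)
    moreover have "0 \<le> C" using super[of 0 0] sub[of 0 0] by linarith
    ultimately show ?thesis by (simp add: mult.commute)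
  qed
  \<comment> \<open>By \<open>cross\<close>, every quotient in \<open>S\<close> lies below every
    \<open>(g k + C) / real k\<close>, so the supremum of \<open>S\<close> separates the two
    families and serves as the slope.\<close>
  define S where "S = (\<lambda>j. g j / real j) ` {1..}"
  have ub: "s \<le> (g k + C) / real k" if "s \<in> S" "k \<ge> 1" for s k
    using that cross unfolding S_def by (auto simp: field_simps)
  have bdd: "bdd_above S" using ub[of _ 1] by (auto simp: bdd_above_def)
  show thesis
  proof (rule that[of "Sup S"])
    fix k :: nat assume k: "k \<ge> 1"
    have "g k / real k \<le> Sup S" by (rule cSup_upper[OF _ bdd]) (use k in \<open>auto simp: S_def\<close>)
    then show "g k \<le> real k * Sup S" using k by (simp add: field_simps)
    have "Sup S \<le> (g k + C) / real k" by (rule cSup_least) (use ub k in \<open>auto simp: S_def\<close>)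
    then show "real k * Sup S \<le> g k + C" using k by (simp add: field_simps)
  qed
qed

text \<open>The minimum principle in abstract form. If \<open>h k c\<close> dominates a convex
  combination of \<open>h k s\<close> and \<open>\<mu> k\<close> with weight \<open>\<delta>\<close>
  independent of \<open>k\<close>, then boundedness of \<open>h k c - \<mu> k\<close> from above
  forces that of \<open>h k s - \<mu> k\<close>; this is iterated along a path.\<close>

lemma minimum_propagation:
  fixes h :: "nat \<Rightarrow> 'a::finite \<Rightarrow> real" and \<mu> :: "nat \<Rightarrow> real"
  assumes conn: "\<And>c s. (c, s) \<in> E\<^sup>*"
    and step: "\<And>c s. (c, s) \<in> E \<Longrightarrow> \<exists>\<delta>>0. \<exists>K. \<forall>k. \<delta> * h k s + (1 - \<delta>) * \<mu> k - K \<le> h k c"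
    and start: "\<And>k. \<exists>c. h k c \<le> \<mu> k + K0"
  obtains K where "\<And>k s. h k s \<le> \<mu> k + K"
proof -
  \<comment> \<open>The assumption on \<open>h k c\<close> stays inside the quantifier over
    \<open>k\<close>, because the node where \<open>h k\<close> is nearly minimal may change with
    \<open>k\<close>.\<close>
  have "\<exists>K. \<forall>k. h k c \<le> \<mu> k + K0 \<longrightarrow> h k s \<le> \<mu> k + K" for c s
    using conn[of c s]
  proof (induction rule: rtrancl_induct)
    case base
    show ?case by blast
  next
    case (step s t)
    then obtain K where K: "\<And>k. h k c \<le> \<mu> k + K0 \<Longrightarrow> h k s \<le> \<mu> k + K" by blast
    obtain \<delta> K' where \<delta>: "\<delta> > 0" and K': "\<And>k. \<delta> * h k t + (1 - \<delta>) * \<mu> k - K' \<le> h k s"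
      using assms(2)[OF step(2)] by blast
    have "h k t \<le> \<mu> k + (K + K') / \<delta>" if "h k c \<le> \<mu> k + K0" for k
    proof -
      have "\<delta> * (h k t - \<mu> k) \<le> K + K'" using K[OF that] K'[of k] by (simp add: algebra_simps)
      then show ?thesis using \<delta> by (simp add: field_simps)
    qed
    then show ?case by blast
  qed
  then obtain F where F: "\<And>c s k. h k c \<le> \<mu> k + K0 \<Longrightarrow> h k s \<le> \<mu> k + F c s" by metis
  \<comment> \<open>Maximizing over all pairs of nodes removes the dependence on the starting node,
    and hence on \<open>k\<close>.\<close>
  define K where "K = Max (range (\<lambda>(c, s). F c s))"
  have "h k s \<le> \<mu> k + K" for k s
  proof -
    obtain c where "h k c \<le> \<mu> k + K0" using start by blast
    then have "h k s \<le> \<mu> k + F c s" by (rule F)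
    also have "F c s \<le> K" unfolding K_def by (rule Max_ge) (auto intro: rev_image_eqI[of "(c, s)"])
    finally show ?thesis by simp
  qed
  then show thesis by (rule that)
qed


section \<open>Families that permute blocks\<close>

text \<open>The partition is encoded by the label \<open>bl\<close> of each index, the permutation
  of cones by the zero pattern of the letters, and irreducibility by reachability: an edge
  \<open>(c, s)\<close> says that some letter maps the basis vector at \<open>c\<close> to a vector
  with nonzero coordinate \<open>s\<close>. Fixing \<open>v\<close> and \<open>x\<close> lets all
  constants depend on them.\<close>

locale block_permuting_family =
  fixes m :: nat and p :: "nat \<Rightarrow> real" and A :: "('n::finite) family"
    and r :: nat and bl :: "'n \<Rightarrow> nat" and v x :: "real ^ 'n"
  assumes p_pos: "d \<in> {1..m} \<Longrightarrow> 0 < p d"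
    and p_sum: "(\<Sum>d=1..m. p d) = 1"
    and row_semipositive: "d \<in> {1..m} \<Longrightarrow> semipositive (row i (A d))"
    and column_semipositive: "d \<in> {1..m} \<Longrightarrow> semipositive (column i (A d))"
    and blocks: "range bl = {1..r}"
    and permutes_blocks: "d \<in> {1..m} \<Longrightarrow>
      \<exists>\<sigma>. \<sigma> permutes {1..r} \<and> (\<forall>i c. A d $ i $ c \<noteq> 0 \<longrightarrow> bl i = \<sigma> (bl c))"
    and connected: "(c, s) \<in> {(c, s). \<exists>d\<in>{1..m}. A d $ s $ c \<noteq> 0}\<^sup>*"
    and positive_word: "\<exists>q. \<exists>W\<in>words m q. \<forall>i c. bl i = bl c \<longrightarrow> 0 < word_prod A W $ i $ c"
    and v_pos: "0 < v $ i"
    and x_pos: "0 < x $ i"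
begin

abbreviation E :: "nat \<Rightarrow> (real ^ 'n ^ 'n \<Rightarrow> real) \<Rightarrow> real" where
  "E k g \<equiv> expect m p A k g"

text \<open>This class contains every letter and is closed under products, so it contains all word
  products; inequalities between expectations are checked on it alone.\<close>

definition admissible :: "real ^ 'n ^ 'n \<Rightarrow> bool" where
  "admissible B \<longleftrightarrow> (\<forall>i. semipositive (row i B)) \<and> (\<forall>c. semipositive (column c B)) \<and>
     (\<exists>\<sigma>. \<sigma> permutes {1..r} \<and> (\<forall>i c. B $ i $ c \<noteq> 0 \<longrightarrow> bl i = \<sigma> (bl c)))"

lemma admissible_nonneg: "admissible B \<Longrightarrow> 0 \<le> B $ i $ c"
  using semipositive_nonneg[of "row i B" c] by (simp add: admissible_def row_def)

text \<open>Stated through rows and columns so that it applies to a transpose as well, which handles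
  the rows of a product in \<open>admissible_mult\<close>.\<close>

lemma semipositive_mult:
  assumes rows: "\<And>i. semipositive (row i B)" and cols: "\<And>c. semipositive (column c B)"
    and z: "semipositive z"
  shows "semipositive (B *v z)"
proof -
  have nonneg: "0 \<le> B $ i $ c" for i c
    using semipositive_nonneg[OF rows[of i], of c] by (simp add: row_def)
  obtain c where c: "0 < z $ c" using z by (rule semipositive_obtain)
  obtain i where i: "0 < column c B $ i" using cols[of c] by (rule semipositive_obtain)
  show ?thesis
  proof (rule semipositiveI[of _ i])
    show "0 \<le> (B *v z) $ i" for i
      unfolding matrix_vector_mult_def
      by (auto intro!: sum_nonneg mult_nonneg_nonneg nonneg semipositive_nonneg[OF z])
    have "0 < (\<Sum>j\<in>UNIV. B $ i $ j * z $ j)"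
      by (rule sum_pos2[of _ c])
        (use c i in \<open>auto simp: column_def intro!: mult_nonneg_nonneg nonneg semipositive_nonneg[OF z]\<close>)
    then show "0 < (B *v z) $ i" by (simp add: matrix_vector_mult_def)
  qed
qed

lemma admissible_mult_vector: "admissible B \<Longrightarrow> semipositive z \<Longrightarrow> semipositive (B *v z)"
  by (rule semipositive_mult) (auto simp: admissible_def)

lemma admissible_letter: "d \<in> {1..m} \<Longrightarrow> admissible (A d)"
  using row_semipositive column_semipositive permutes_blocks by (auto simp: admissible_def)

lemma admissible_one: "admissible (mat 1)"
proof -
  have "row i (mat 1 :: real ^ 'n ^ 'n) = axis i 1" "column i (mat 1 :: real ^ 'n ^ 'n) = axis i 1" for i
    by (auto simp: vec_eq_iff row_def column_def mat_def axis_def)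
  then show ?thesis
    by (auto simp: admissible_def semipositive_axis mat_def intro!: exI[of _ id] permutes_id)
qed

lemma admissible_mult:
  assumes B: "admissible B" and C: "admissible C"
  shows "admissible (B ** C)"
proof -
  have "row i (B ** C) = transpose C *v row i B" for i
    by (simp add: vec_eq_iff row_def matrix_matrix_mult_def matrix_vector_mult_def transpose_def mult.commute)
  moreover have "column c (B ** C) = B *v column c C" for c
    by (simp add: vec_eq_iff column_def matrix_matrix_mult_def matrix_vector_mult_def)
  moreover have "semipositive (transpose C *v row i B)" for i
    by (rule semipositive_mult) (use B C in \<open>auto simp: admissible_def\<close>)
  moreover have "semipositive (B *v column c C)" for c
    by (rule admissible_mult_vector[OF B]) (use C in \<open>auto simp: admissible_def\<close>)
  moreover obtain \<sigma> \<tau> where \<sigma>: "\<sigma> permutes {1..r}" "\<And>i c. B $ i $ c \<noteq> 0 \<Longrightarrow> bl i = \<sigma> (bl c)"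
    and \<tau>: "\<tau> permutes {1..r}" "\<And>i c. C $ i $ c \<noteq> 0 \<Longrightarrow> bl i = \<tau> (bl c)"
    using B C unfolding admissible_def by metis
  moreover have "bl i = (\<sigma> \<circ> \<tau>) (bl c)" if "(B ** C) $ i $ c \<noteq> 0" for i c
  proof -
    obtain j where "B $ i $ j \<noteq> 0" "C $ j $ c \<noteq> 0"
      using \<open>(B ** C) $ i $ c \<noteq> 0\<close> by (rule matrix_mult_nonzeroE)
    then show ?thesis using \<sigma>(2)[of i j] \<tau>(2)[of j c] by simp
  qed
  ultimately show ?thesis
    unfolding admissible_def using permutes_compose[OF \<tau>(1) \<sigma>(1)] by auto
qed

lemma admissible_word_prod: "set ds \<subseteq> {1..m} \<Longrightarrow> admissible (word_prod A ds)"
  by (induction ds) (simp_all add: admissible_one admissible_mult admissible_letter)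

lemma prob_pos: "ds \<in> words m k \<Longrightarrow> 0 < prod_list (map p ds)"
  unfolding words_def by (induction ds arbitrary: k) (auto simp: p_pos)

lemma E_const: "E k (\<lambda>B. c) = c"
proof (induction k)
  case (Suc k)
  have "E (Suc k) (\<lambda>B. c) = (\<Sum>d=1..m. p d) * c"
    by (simp only: expect_Suc Suc.IH sum_distrib_right)
  then show ?case by (simp only: p_sum)
qed (simp add: expect_0)

lemma E_mono:
  assumes "\<And>B. admissible B \<Longrightarrow> g B \<le> h B"
  shows "E k g \<le> E k h"
  unfolding expect_def
proof (rule sum_mono, rule mult_left_mono)
  fix ds assume ds: "ds \<in> words m k"
  then show "g (word_prod A ds) \<le> h (word_prod A ds)"
    by (intro assms admissible_word_prod) (simp add: words_def)
  show "0 \<le> prod_list (map p ds)" by (rule less_imp_le[OF prob_pos[OF ds]])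
qed

lemma E_cong: "(\<And>B. admissible B \<Longrightarrow> g B = h B) \<Longrightarrow> E k g = E k h"
  by (intro antisym E_mono) auto

lemma E_abs: "\<bar>E k g\<bar> \<le> E k (\<lambda>B. \<bar>g B\<bar>)"
proof -
  have "E k (\<lambda>B. - 1 * g B) \<le> E k (\<lambda>B. \<bar>g B\<bar>)" and "E k g \<le> E k (\<lambda>B. \<bar>g B\<bar>)"
    by (rule E_mono; simp)+
  then show ?thesis unfolding expect_cmult by linarith
qed

lemma E_add_const: "E k (\<lambda>B. g B + c) = E k g + c"
  by (simp add: expect_add E_const)

section \<open>Column growth and its concave lower bound\<close>

definition log_growth :: "nat \<Rightarrow> real ^ 'n \<Rightarrow> real" where
  "log_growth k y = E k (\<lambda>B. ln (v \<bullet> (B *v y)))"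

text \<open>For \<open>k \<ge> 1\<close> this is \<open>k\<close> times
  \<open>beta m p A k v\<close>.\<close>

definition column_growth :: "nat \<Rightarrow> real" where
  "column_growth k = (MIN c. - ln (v $ c) + log_growth k (axis c 1))"

lemma column_growth_le: "column_growth k \<le> - ln (v $ c) + log_growth k (axis c 1)"
  unfolding column_growth_def by (rule Min_le) auto

lemma column_growth_attained:
  obtains c where "column_growth k = - ln (v $ c) + log_growth k (axis c 1)"
proof -
  have "column_growth k \<in> range (\<lambda>c. - ln (v $ c) + log_growth k (axis c 1))"
    unfolding column_growth_def by (rule Min_in) auto
  then show thesis using that by auto
qed

lemma weight_pos: "semipositive y \<Longrightarrow> 0 < v \<bullet> y"
  by (rule inner_semipositive_pos[OF v_pos])

lemma weight_mult_pos: "admissible B \<Longrightarrow> semipositive y \<Longrightarrow> 0 < v \<bullet> (B *v y)"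
  by (intro weight_pos admissible_mult_vector)

lemma log_growth_add: "log_growth (l + k) y = E l (\<lambda>W. log_growth k (W *v y))"
  by (simp add: log_growth_def expect_append matrix_vector_mul_assoc)

lemma log_growth_mono:
  assumes y: "semipositive y" and le: "\<And>i. y $ i \<le> z $ i"
  shows "log_growth k y \<le> log_growth k z"
  unfolding log_growth_def
proof (rule E_mono)
  fix B assume B: "admissible B"
  have "v \<bullet> (B *v y) \<le> v \<bullet> (B *v z)"
    unfolding inner_vec_def matrix_vector_mult_def
    using le admissible_nonneg[OF B] less_imp_le[OF v_pos]
    by (auto intro!: sum_mono mult_left_mono)
  then show "ln (v \<bullet> (B *v y)) \<le> ln (v \<bullet> (B *v z))"
    using weight_mult_pos[OF B y] by simp
qed

lemma log_growth_scale:
  assumes y: "semipositive y" and t: "0 < t"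
  shows "log_growth k (t *\<^sub>R y) = ln t + log_growth k y"
proof -
  have "log_growth k (t *\<^sub>R y) = E k (\<lambda>B. ln (v \<bullet> (B *v y)) + ln t)"
    unfolding log_growth_def
  proof (rule E_cong)
    fix B assume "admissible B"
    then show "ln (v \<bullet> (B *v (t *\<^sub>R y))) = ln (v \<bullet> (B *v y)) + ln t"
      using t weight_mult_pos[OF _ y, of B] by (simp add: ln_mult_pos matrix_vector_mult_scaleR)
  qed
  then show ?thesis by (simp add: E_add_const log_growth_def)
qed

text \<open>After division by \<open>v \<bullet> y\<close>, the vector \<open>y\<close> is the
  convex combination, with weights \<open>w c\<close>, of the basis vectors scaled by
  \<open>1 / v $ c\<close>. Jensen's inequality for each \<open>B\<close> bounds the growth of
  \<open>y\<close> below by the average over columns, hence by their minimum.\<close>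

lemma log_growth_lower:
  assumes y: "semipositive y"
  shows "ln (v \<bullet> y) + column_growth k \<le> log_growth k y"
proof -
  define w where "w c = v $ c * y $ c / (v \<bullet> y)" for c
  note Y = weight_pos[OF y]
  have w: "0 \<le> w c" for c
    unfolding w_def using Y v_pos semipositive_nonneg[OF y] by (simp add: less_imp_le)
  have sum_w: "(\<Sum>c\<in>UNIV. w c) = 1"
    using Y by (simp add: w_def inner_vec_def flip: sum_divide_distrib)
  have "ln (v \<bullet> y) + column_growth k
      = ln (v \<bullet> y) + (\<Sum>c\<in>UNIV. w c * column_growth k)"
    by (simp add: sum_w flip: sum_distrib_right)
  also have "\<dots> \<le> ln (v \<bullet> y) + (\<Sum>c\<in>UNIV. w c * (- ln (v $ c) + log_growth k (axis c 1)))"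
    by (intro add_left_mono sum_mono mult_left_mono column_growth_le w)
  also have "\<dots> = E k (\<lambda>B. (\<Sum>c\<in>UNIV. w c * (ln (v \<bullet> (B *v axis c 1)) + - ln (v $ c))) + ln (v \<bullet> y))"
    by (simp only: E_add_const expect_sum expect_cmult log_growth_def) (simp only: add.commute)
  also have "\<dots> \<le> log_growth k y"
    unfolding log_growth_def
  proof (rule E_mono)
    fix B assume B: "admissible B"
    let ?t = "\<lambda>c. v \<bullet> (B *v axis c 1) / v $ c"
    have t: "0 < ?t c" for c using weight_mult_pos[OF B semipositive_axis] v_pos by simp
    have "(\<Sum>c\<in>UNIV. w c * ?t c) = (\<Sum>c\<in>UNIV. y $ c * (v \<bullet> (B *v axis c 1)) / (v \<bullet> y))"
      using v_pos by (intro sum.cong) (auto simp: w_def less_imp_neq[symmetric])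
    also have "\<dots> = v \<bullet> (B *v y) / (v \<bullet> y)"
      unfolding inner_matrix_vector[of v B y] inner_vec_def[of "v v* B" y]
      by (simp add: vector_matrix_component matrix_vector_mult_basis mult.commute
          flip: sum_divide_distrib)
    finally have *: "(\<Sum>c\<in>UNIV. w c * ?t c) = v \<bullet> (B *v y) / (v \<bullet> y)" .
    have "(\<Sum>c\<in>UNIV. w c * ln (?t c)) \<le> ln (\<Sum>c\<in>UNIV. w c * ?t c)"
      by (rule weighted_sum_ln_le) (use w t sum_w in auto)
    also have "\<dots> = ln (v \<bullet> (B *v y)) - ln (v \<bullet> y)"
      unfolding * using Y weight_mult_pos[OF B y] by (simp add: ln_div)
    finally have "(\<Sum>c\<in>UNIV. w c * ln (?t c)) \<le> ln (v \<bullet> (B *v y)) - ln (v \<bullet> y)" .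
    moreover have "ln (?t c) = ln (v \<bullet> (B *v axis c 1)) + - ln (v $ c)" for c
      using v_pos[of c] weight_mult_pos[OF B semipositive_axis, of c] by (simp add: ln_div)
    ultimately show "(\<Sum>c\<in>UNIV. w c * (ln (v \<bullet> (B *v axis c 1)) + - ln (v $ c))) + ln (v \<bullet> y)
        \<le> ln (v \<bullet> (B *v y))"
      by simp
  qed
  finally show ?thesis .
qed

text \<open>No column of \<open>W\<close> vanishes, so \<open>v v* W\<close> is again strictly
  positive and comparable with \<open>v\<close>.\<close>

lemma log_weight_admissible_step:
  assumes W: "admissible W"
  obtains K where "0 \<le> K" "\<And>z. semipositive z \<Longrightarrow> \<bar>ln (v \<bullet> (W *v z)) - ln (v \<bullet> z)\<bar> \<le> K"
proof -
  have "0 < (v v* W) $ c" for c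
    unfolding vector_matrix_component
    by (rule weight_pos) (use W in \<open>simp add: admissible_def\<close>)
  then show thesis
    by (rule ln_inner_comparable[OF _ v_pos]) (use that in \<open>auto simp: inner_matrix_vector\<close>)
qed

lemma log_weight_letter_step:
  obtains K where "0 \<le> K"
    "\<And>d z. d \<in> {1..m} \<Longrightarrow> semipositive z \<Longrightarrow> \<bar>ln (v \<bullet> (A d *v z)) - ln (v \<bullet> z)\<bar> \<le> K"
proof -
  have "\<exists>K. \<forall>z. semipositive z \<longrightarrow> \<bar>ln (v \<bullet> (A d *v z)) - ln (v \<bullet> z)\<bar> \<le> K" if "d \<in> {1..m}" for d
    using log_weight_admissible_step[OF admissible_letter[OF that]] by metis
  then obtain K where K: "\<And>d z. d \<in> {1..m} \<Longrightarrow> semipositive z \<Longrightarrow>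
      \<bar>ln (v \<bullet> (A d *v z)) - ln (v \<bullet> z)\<bar> \<le> K d"
    by metis
  have "\<bar>ln (v \<bullet> (A d *v z)) - ln (v \<bullet> z)\<bar> \<le> (\<Sum>d=1..m. \<bar>K d\<bar>)"
    if d: "d \<in> {1..m}" and "semipositive z" for d z
  proof -
    have "\<bar>ln (v \<bullet> (A d *v z)) - ln (v \<bullet> z)\<bar> \<le> \<bar>K d\<bar>" using K[OF that] by linarith
    also have "\<dots> \<le> (\<Sum>d=1..m. \<bar>K d\<bar>)" by (rule member_le_sum[OF d]) auto
    finally show ?thesis .
  qed
  then show thesis by (rule that[rotated]) (auto intro: sum_nonneg)
qed

text \<open>The extra letters act after the first \<open>k\<close>. Each of them changes the
  logarithmic weight by a bounded amount, whatever semipositive vector it meets.\<close>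

lemma log_growth_shift:
  obtains K where "\<And>k y. semipositive y \<Longrightarrow> \<bar>log_growth (k + q) y - log_growth k y\<bar> \<le> K"
proof -
  obtain K where K: "\<And>d z. d \<in> {1..m} \<Longrightarrow> semipositive z \<Longrightarrow>
      \<bar>ln (v \<bullet> (A d *v z)) - ln (v \<bullet> z)\<bar> \<le> K"
    by (rule log_weight_letter_step) blast
  have step: "\<bar>log_growth (k + 1) y - log_growth k y\<bar> \<le> K" if y: "semipositive y" for k y
  proof -
    have "log_growth (k + 1) y - log_growth k y
        = E k (\<lambda>B. E 1 (\<lambda>W. ln (v \<bullet> (W *v (B *v y)))) - ln (v \<bullet> (B *v y)))"
      by (simp only: log_growth_add expect_diff) (simp add: log_growth_def)
    also have "\<bar>\<dots>\<bar> \<le> E k (\<lambda>B. \<bar>E 1 (\<lambda>W. ln (v \<bullet> (W *v (B *v y)))) - ln (v \<bullet> (B *v y))\<bar>)"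
      by (rule E_abs)
    also have "\<dots> \<le> E k (\<lambda>B. K)"
    proof (rule E_mono)
      fix B assume B: "admissible B"
      let ?z = "B *v y"
      have "E 1 (\<lambda>W. ln (v \<bullet> (W *v ?z))) - ln (v \<bullet> ?z) = (\<Sum>d=1..m. p d * (ln (v \<bullet> (A d *v ?z)) - ln (v \<bullet> ?z)))"
        by (simp add: expect_1[unfolded One_nat_def] right_diff_distrib sum_subtractf p_sum[unfolded One_nat_def] flip: sum_distrib_right)
      also have "\<bar>\<dots>\<bar> \<le> (\<Sum>d=1..m. p d * K)"
        by (rule order.trans[OF sum_abs], rule sum_mono)
          (use K[OF _ admissible_mult_vector[OF B y]] p_pos in \<open>auto simp: abs_mult less_imp_le intro!: mult_mono\<close>)
      also have "\<dots> = K" by (simp add: p_sum[unfolded One_nat_def] flip: sum_distrib_right)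
      finally show "\<bar>E 1 (\<lambda>W. ln (v \<bullet> (W *v ?z))) - ln (v \<bullet> ?z)\<bar> \<le> K" .
    qed
    finally show ?thesis by (simp add: E_const)
  qed
  have "\<bar>log_growth (k + q) y - log_growth k y\<bar> \<le> real q * K" if y: "semipositive y" for k y
  proof (induction q)
    case (Suc q)
    then show ?case using step[OF y, of "k + q"] by (simp add: algebra_simps)
  qed simp
  then show thesis by (rule that)
qed

text \<open>For a column minimizing at length \<open>k + l\<close>, condition on the first
  \<open>k\<close> letters and apply \<open>log_growth_lower\<close> to the remaining
  \<open>l\<close>.\<close>

lemma column_growth_superadditive: "column_growth k + column_growth l \<le> column_growth (k + l)"
proof -
  obtain c where c: "column_growth (k + l) = - ln (v $ c) + log_growth (k + l) (axis c 1)"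
    by (rule column_growth_attained)
  have "log_growth k (axis c 1) + column_growth l
      = E k (\<lambda>W. ln (v \<bullet> (W *v axis c 1)) + column_growth l)"
    by (simp add: E_add_const log_growth_def)
  also have "\<dots> \<le> log_growth (k + l) (axis c 1)"
    unfolding log_growth_add
    by (intro E_mono log_growth_lower admissible_mult_vector semipositive_axis)
  finally show ?thesis using column_growth_le[of k c] c by linarith
qed

text \<open>The minimum principle for one word. Conditioning on the first \<open>q\<close> letters,
  \<open>W\<close> contributes at least the growth of \<open>y\<close> by monotonicity, and every
  other word at least \<open>column_growth k\<close> up to a constant by
  \<open>log_growth_lower\<close>. \<open>log_growth_shift\<close> then returns from length
  \<open>q + k\<close> to \<open>k\<close>.\<close>

lemma log_growth_absorb:
  assumes W: "W \<in> words m q" and y: "semipositive y"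
    and le: "\<And>i. y $ i \<le> (word_prod A W *v axis c 1) $ i"
  shows "\<exists>K. \<forall>k. prod_list (map p W) * log_growth k y + (1 - prod_list (map p W)) * column_growth k - K
      \<le> log_growth k (axis c 1)"
proof -
  let ?P = "\<lambda>W. prod_list (map p W)" and ?z = "\<lambda>W. word_prod A W *v axis c 1"
  \<comment> \<open>The logarithms of the starting weights after the words other than
    \<open>W\<close>, in absolute value and weighted by probability.\<close>
  define K1 where "K1 = (\<Sum>W'\<in>words m q - {W}. ?P W' * \<bar>ln (v \<bullet> ?z W')\<bar>)"
  obtain K2 where K2: "\<And>k y. semipositive y \<Longrightarrow> \<bar>log_growth (k + q) y - log_growth k y\<bar> \<le> K2"
    by (rule log_growth_shift) blast
  have z: "semipositive (?z W')" if "W' \<in> words m q" for W'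
    by (intro admissible_mult_vector admissible_word_prod semipositive_axis)
      (use that in \<open>auto simp: words_def\<close>)
  have total: "(\<Sum>W'\<in>words m q - {W}. ?P W') = 1 - ?P W"
    using E_const[of q 1] W by (simp add: expect_def sum_diff1 finite_words)
  have "?P W * log_growth k y + (1 - ?P W) * column_growth k - (K1 + K2) \<le> log_growth k (axis c 1)" for k
  proof -
    have "(1 - ?P W) * column_growth k - K1
        = (\<Sum>W'\<in>words m q - {W}. ?P W' * (- \<bar>ln (v \<bullet> ?z W')\<bar> + column_growth k))"
      by (simp add: right_diff_distrib sum_subtractf K1_def sum_distrib_right flip: total)
    also have "\<dots> \<le> (\<Sum>W'\<in>words m q - {W}. ?P W' * log_growth k (?z W'))"
    proof (rule sum_mono, rule mult_left_mono)
      fix W' assume "W' \<in> words m q - {W}"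
      then show "- \<bar>ln (v \<bullet> ?z W')\<bar> + column_growth k \<le> log_growth k (?z W')" "0 \<le> ?P W'"
        using log_growth_lower[OF z, of W' k] prob_pos[of W' q] by auto
    qed
    finally have "?P W * log_growth k y + (1 - ?P W) * column_growth k - K1
        \<le> ?P W * log_growth k (?z W) + (\<Sum>W'\<in>words m q - {W}. ?P W' * log_growth k (?z W'))"
      using mult_left_mono[OF log_growth_mono[OF y le] less_imp_le[OF prob_pos[OF W]], of k] by simp
    also have "\<dots> = log_growth (q + k) (axis c 1)"
      unfolding log_growth_add expect_def by (rule sum.remove[symmetric, OF finite_words W])
    also have "\<dots> \<le> log_growth k (axis c 1) + K2"
      using K2[OF semipositive_axis, of k c] by (simp add: add.commute)
    finally show ?thesis by simp
  qed
  then show ?thesis by blast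
qed

text \<open>\<open>minimum_propagation\<close> starts at a minimizing column and reaches every
  column through the edges of the family.\<close>

lemma log_growth_column_upper:
  obtains K where "\<And>k c. log_growth k (axis c 1) \<le> column_growth k + K"
proof -
  have step: "\<exists>\<delta>>0. \<exists>K. \<forall>k. \<delta> * log_growth k (axis s 1) + (1 - \<delta>) * column_growth k - K \<le> log_growth k (axis c 1)"
    if edge: "(c, s) \<in> {(c, s). \<exists>d\<in>{1..m}. A d $ s $ c \<noteq> 0}" for c s
  proof -
    obtain d where d: "d \<in> {1..m}" "A d $ s $ c \<noteq> 0" using edge by blast
    define a where "a = A d $ s $ c"
    have a: "0 < a"
      using d(2) admissible_nonneg[OF admissible_letter[OF d(1)], of s c] unfolding a_def by linarith
    have W: "[d] \<in> words m 1" using d by (simp add: words_def)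
    \<comment> \<open>Keeping only coordinate \<open>s\<close> of column \<open>c\<close> of
      \<open>A d\<close> gives a vector below that column, so \<open>log_growth_absorb\<close>
      applies to the one-letter word.\<close>
    have "semipositive (a *\<^sub>R axis s (1::real))"
      by (rule semipositiveI[of _ s]) (use a in \<open>auto simp: axis_def\<close>)
    moreover have "(a *\<^sub>R axis s 1) $ i \<le> (word_prod A [d] *v axis c 1) $ i" for i
      using admissible_nonneg[OF admissible_letter[OF d(1)], of i c]
      by (simp add: matrix_vector_mult_basis column_def a_def) (simp add: axis_def)
    ultimately obtain K where K: "\<And>k. p d * log_growth k (a *\<^sub>R axis s 1) + (1 - p d) * column_growth k - K
        \<le> log_growth k (axis c 1)"
      using log_growth_absorb[OF W] by fastforce
    have "p d * log_growth k (axis s 1) + (1 - p d) * column_growth k - (K - p d * ln a)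
        \<le> log_growth k (axis c 1)" for k
      using K[of k] by (simp add: log_growth_scale[OF semipositive_axis a] algebra_simps)
    then show ?thesis using p_pos[OF d(1)] by blast
  qed
  \<comment> \<open>The offset absorbs the term \<open>- ln (v $ c)\<close> in the expression that
    the column minimizes.\<close>
  have start: "\<exists>c. log_growth k (axis c 1) \<le> column_growth k + Max (range (\<lambda>c. ln (v $ c)))" for k
  proof -
    obtain c where c: "column_growth k = - ln (v $ c) + log_growth k (axis c 1)"
      by (rule column_growth_attained)
    have "ln (v $ c) \<le> Max (range (\<lambda>c. ln (v $ c)))" by (rule Max_ge) auto
    with c have "log_growth k (axis c 1) \<le> column_growth k + Max (range (\<lambda>c. ln (v $ c)))" by linarith
    then show ?thesis by blast
  qed
  obtain K where "\<And>k c. log_growth k (axis c 1) \<le> column_growth k + K"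
    by (rule minimum_propagation[where h = "\<lambda>k c. log_growth k (axis c 1)" and \<mu> = column_growth,
          OF connected step start]) blast+
  then show thesis by (rule that)
qed

section \<open>Vectors supported in a single block\<close>

definition block_vector :: "real ^ 'n \<Rightarrow> bool" where
  "block_vector y \<longleftrightarrow> semipositive y \<and> (\<exists>n\<in>{1..r}. \<forall>c. y $ c \<noteq> 0 \<longrightarrow> bl c = n)"

definition block_indicator :: "nat \<Rightarrow> real ^ 'n" where
  "block_indicator n = (\<chi> c. if bl c = n then 1 else 0)"

lemma block_range: "bl c \<in> {1..r}"
  using blocks by blast

lemma block_nonempty:
  assumes "n \<in> {1..r}"
  obtains c where "bl c = n"
  using assms blocks by (metis imageE)

lemma block_vector_indicator: "n \<in> {1..r} \<Longrightarrow> block_vector (block_indicator n)"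
proof -
  assume n: "n \<in> {1..r}"
  then obtain c where "bl c = n" by (rule block_nonempty)
  then have "semipositive (block_indicator n)"
    by (intro semipositiveI[of _ c]) (auto simp: block_indicator_def)
  then show ?thesis using n by (auto simp: block_vector_def block_indicator_def intro!: bexI[of _ n])
qed

lemma block_vector_axis: "block_vector (axis c 1)"
  using block_range[of c] unfolding block_vector_def
  by (intro conjI semipositive_axis bexI[of _ "bl c"]) (auto simp: axis_def)

lemma block_vector_semipositive: "block_vector y \<Longrightarrow> semipositive y"
  by (simp add: block_vector_def)

lemma block_vector_mult:
  assumes B: "admissible B" and y: "block_vector y"
  shows "block_vector (B *v y)"
proof -
  obtain n where n: "n \<in> {1..r}" "\<And>c. y $ c \<noteq> 0 \<Longrightarrow> bl c = n"
    using y by (auto simp: block_vector_def)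
  obtain \<sigma> where \<sigma>: "\<sigma> permutes {1..r}" "\<And>i c. B $ i $ c \<noteq> 0 \<Longrightarrow> bl i = \<sigma> (bl c)"
    using B unfolding admissible_def by metis
  have "bl i = \<sigma> n" if i: "(B *v y) $ i \<noteq> 0" for i
  proof -
    obtain c where "B $ i $ c \<noteq> 0" "y $ c \<noteq> 0" using i by (rule matrix_vector_nonzeroE)
    then show ?thesis using \<sigma>(2)[of i c] n(2)[of c] by simp
  qed
  moreover have "\<sigma> n \<in> {1..r}" using \<sigma>(1) n(1) by (simp only: permutes_in_image)
  ultimately show ?thesis
    using admissible_mult_vector[OF B block_vector_semipositive[OF y]] by (auto simp: block_vector_def)
qed

text \<open>The block-positive word spreads a basis vector over its whole block, so the column bound
  extends to block indicators by \<open>log_growth_absorb\<close>. Any block vector lies below its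
  coordinate sum times the indicator of its block.\<close>

lemma log_growth_block_upper:
  obtains K where "\<And>k y. block_vector y \<Longrightarrow> log_growth k y \<le> ln (v \<bullet> y) + column_growth k + K"
proof -
  obtain K1 where K1: "\<And>k c. log_growth k (axis c 1) \<le> column_growth k + K1"
    by (rule log_growth_column_upper) blast
  obtain q W where W: "W \<in> words m q" and pos: "\<And>i c. bl i = bl c \<Longrightarrow> 0 < word_prod A W $ i $ c"
    using positive_word by blast
  define D where "D = word_prod A W"
  have D: "admissible D" unfolding D_def by (rule admissible_word_prod) (use W in \<open>simp add: words_def\<close>)
  \<comment> \<open>The least entry of \<open>D\<close> inside the diagonal blocks, positive because
    it is a minimum over finitely many positive entries.\<close>
  define \<delta> where "\<delta> = Min ((\<lambda>(i, c). D $ i $ c) ` {(i, c). bl i = bl c})"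
  have \<delta>_pos: "0 < \<delta>"
    unfolding \<delta>_def using pos by (subst Min_gr_iff) (auto simp: D_def)
  have \<delta>_le: "\<delta> \<le> D $ i $ c" if "bl i = bl c" for i c
    unfolding \<delta>_def by (rule Min_le) (use that in force)+
  let ?P = "prod_list (map p W)"
  have P: "0 < ?P" by (rule prob_pos[OF W])
  have "\<exists>K. \<forall>k. log_growth k (block_indicator (bl c)) \<le> column_growth k + K" for c
  proof -
    let ?y = "block_indicator (bl c)"
    have y: "semipositive ?y" by (intro block_vector_semipositive block_vector_indicator block_range)
    have "(\<delta> *\<^sub>R ?y) $ i \<le> (D *v axis c 1) $ i" for i
      using \<delta>_le[of i c] admissible_nonneg[OF D, of i c]
      by (simp add: matrix_vector_mult_basis column_def block_indicator_def)
    moreover have "semipositive (\<delta> *\<^sub>R ?y)"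
      using y \<delta>_pos by (auto simp: semipositive_def)
    ultimately obtain K2 where
      "\<And>k. ?P * log_growth k (\<delta> *\<^sub>R ?y) + (1 - ?P) * column_growth k - K2 \<le> log_growth k (axis c 1)"
      using log_growth_absorb[OF W, of "\<delta> *\<^sub>R ?y" c] unfolding D_def by blast
    \<comment> \<open>The \<open>column_growth k\<close> terms combine so that only the gap remains,
      multiplied by \<open>?P\<close>; dividing by this fixed positive weight bounds the gap
      uniformly in \<open>k\<close>.\<close>
    then have "?P * (log_growth k ?y - column_growth k) \<le> K1 + K2 - ?P * ln \<delta>" for k
      using K1[of k c] by (simp add: log_growth_scale[OF y \<delta>_pos] algebra_simps) (smt (verit))
    then have "log_growth k ?y \<le> column_growth k + (K1 + K2 - ?P * ln \<delta>) / ?P" for k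
      using P by (simp add: field_simps)
    then show ?thesis by blast
  qed
  then obtain F where F: "\<And>c k. log_growth k (block_indicator (bl c)) \<le> column_growth k + F c" by metis
  define K2 where "K2 = Max (range F)"
  have K2: "F c \<le> K2" for c unfolding K2_def by (rule Max_ge) auto
  \<comment> \<open>Pairing with \<open>?one\<close> is the coordinate sum; \<open>K3\<close> is the
    cost of exchanging it for the weight \<open>v\<close>.\<close>
  let ?one = "\<chi> i. 1 :: real ^ 'n"
  obtain K3 where K3: "\<And>z. semipositive z \<Longrightarrow> \<bar>ln (?one \<bullet> z) - ln (v \<bullet> z)\<bar> \<le> K3"
    by (rule ln_inner_comparable[of ?one v]) (auto simp: v_pos)
  have "log_growth k y \<le> ln (v \<bullet> y) + column_growth k + (K2 + K3)" if y: "block_vector y" for k y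
  proof -
    obtain n where n: "n \<in> {1..r}" "\<And>c. y $ c \<noteq> 0 \<Longrightarrow> bl c = n"
      using y by (auto simp: block_vector_def)
    obtain c where c: "bl c = n" using n(1) by (rule block_nonempty)
    note sy = block_vector_semipositive[OF y]
    have T: "0 < ?one \<bullet> y" by (rule inner_semipositive_pos[OF _ sy]) simp
    have "y $ i \<le> ((?one \<bullet> y) *\<^sub>R block_indicator n) $ i" for i
    proof (cases "bl i = n")
      case True
      have "y $ i \<le> (\<Sum>i\<in>UNIV. y $ i)"
        by (rule member_le_sum) (auto simp: semipositive_nonneg[OF sy])
      with True show ?thesis by (simp add: block_indicator_def inner_vec_def)
    next
      case False
      then have "y $ i = 0" using n(2) by blast
      with False show ?thesis by (simp add: block_indicator_def)
    qed
    then have "log_growth k y \<le> log_growth k ((?one \<bullet> y) *\<^sub>R block_indicator n)"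
      by (rule log_growth_mono[OF sy])
    also have "\<dots> = ln (?one \<bullet> y) + log_growth k (block_indicator n)"
      by (rule log_growth_scale[OF block_vector_semipositive[OF block_vector_indicator[OF n(1)]] T])
    also have "\<dots> \<le> ln (v \<bullet> y) + K3 + (column_growth k + K2)"
      using K3[OF sy] F[of k c] K2[of c] c by simp
    finally show ?thesis by simp
  qed
  then show thesis by (rule that)
qed

text \<open>The upper bound for block vectors makes \<open>column_growth\<close> subadditive up to a
  constant, since products send basis vectors to block vectors. The slope \<open>L\<close> then
  comes from \<open>almost_additive_slope\<close>.\<close>

lemma growth_rate:
  obtains L K where
    "\<And>k. k \<ge> 1 \<Longrightarrow> column_growth k \<le> real k * L"
    "\<And>k. k \<ge> 1 \<Longrightarrow> real k * L \<le> column_growth k + K"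
    "\<And>k y. block_vector y \<Longrightarrow> \<bar>log_growth k y - ln (v \<bullet> y) - real k * L\<bar> \<le> K"
proof -
  obtain K where K: "\<And>k y. block_vector y \<Longrightarrow> log_growth k y \<le> ln (v \<bullet> y) + column_growth k + K"
    by (rule log_growth_block_upper) blast
  have sub: "column_growth (k + l) \<le> column_growth k + column_growth l + K" for k l
  proof -
    \<comment> \<open>The column minimizes at the shorter length \<open>k\<close>, not at
      \<open>k + l\<close> as in the superadditive direction.\<close>
    obtain c where c: "column_growth k = - ln (v $ c) + log_growth k (axis c 1)"
      by (rule column_growth_attained)
    have "log_growth (k + l) (axis c 1) \<le> E k (\<lambda>W. ln (v \<bullet> (W *v axis c 1)) + (column_growth l + K))"
      unfolding log_growth_add
      using K[OF block_vector_mult[OF _ block_vector_axis]] by (intro E_mono) (simp add: add.assoc)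
    also have "\<dots> = log_growth k (axis c 1) + (column_growth l + K)"
      by (simp add: E_add_const log_growth_def)
    finally show ?thesis using column_growth_le[of "k + l" c] c by linarith
  qed
  obtain L where L: "\<And>k. k \<ge> 1 \<Longrightarrow> column_growth k \<le> real k * L"
    "\<And>k. k \<ge> 1 \<Longrightarrow> real k * L \<le> column_growth k + K"
    using almost_additive_slope[OF column_growth_superadditive sub] by blast
  have "\<bar>log_growth k y - ln (v \<bullet> y) - real k * L\<bar> \<le> K" if y: "block_vector y" for k y
  \<comment> \<open>At \<open>k = 0\<close> the left side vanishes, and \<open>0 \<le> K\<close>
    follows from the two slope bounds at length 1.\<close>
  proof (cases "k = 0")
    case True
    then show ?thesis using L[of 1] by (simp add: log_growth_def expect_0)
  next
    case False
    then have "k \<ge> 1" by simp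
    from L[OF this] show ?thesis
      using K[OF y, of k] log_growth_lower[OF block_vector_semipositive[OF y], of k] by linarith
  qed
  with L show thesis by (rule that)
qed

section \<open>Collatz-Wielandt ratios on blocks and their maximum principle\<close>

definition block_ratio :: "nat \<Rightarrow> real ^ 'n ^ 'n \<Rightarrow> real" where
  "block_ratio j B = (MAX i\<in>{i. bl i = j}. ln ((B *v x) $ i / x $ i))"

definition block_growth :: "nat \<Rightarrow> nat \<Rightarrow> real" where
  "block_growth k j = E k (block_ratio j)"

text \<open>For \<open>k \<ge> 1\<close> this is \<open>k\<close> times \<open>alpha_tilde\<close>,
  with the blocks given by labels.\<close>

definition max_growth :: "nat \<Rightarrow> real" where
  "max_growth k = (MAX j\<in>{1..r}. block_growth k j)"

lemma r_pos: "1 \<le> r"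
  using block_range[of undefined] by simp

lemma block_ratio_ge: "bl i = j \<Longrightarrow> ln ((B *v x) $ i / x $ i) \<le> block_ratio j B"
  unfolding block_ratio_def by (rule Max_ge) auto

lemma block_ratio_le:
  assumes "j \<in> {1..r}" and "\<And>i. bl i = j \<Longrightarrow> ln ((B *v x) $ i / x $ i) \<le> t"
  shows "block_ratio j B \<le> t"
proof -
  obtain i where "bl i = j" using assms(1) by (rule block_nonempty)
  then show ?thesis unfolding block_ratio_def using assms(2) by (subst Max_le_iff) auto
qed

lemma block_growth_le_max: "j \<in> {1..r} \<Longrightarrow> block_growth k j \<le> max_growth k"
  unfolding max_growth_def by (rule Max_ge) auto

lemma max_growth_attained:
  obtains c where "max_growth k = block_growth k (bl c)"
proof -
  have "max_growth k \<in> block_growth k ` {1..r}"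
    unfolding max_growth_def by (rule Max_in) (use r_pos in auto)
  then show thesis using that by (metis block_nonempty imageE)
qed

lemma row_mult_pos:
  assumes "admissible B" and "\<And>i. 0 < y $ i"
  shows "0 < (B *v y) $ i"
  unfolding matrix_vector_component
  using inner_semipositive_pos[of y "row i B"] assms by (simp add: admissible_def inner_commute)

text \<open>Rows of \<open>C\<close> in block \<open>\<sigma> n\<close> are supported on block
  \<open>n\<close>, where \<open>B *v x\<close> is at most \<open>exp (block_ratio n B)\<close>
  times \<open>x\<close>; applying \<open>C\<close> preserves this bound on block
  \<open>\<sigma> n\<close>.\<close>

lemma block_ratio_mult:
  assumes C: "admissible C" and B: "admissible B"
    and \<sigma>: "\<sigma> permutes {1..r}" "\<And>i c. C $ i $ c \<noteq> 0 \<Longrightarrow> bl i = \<sigma> (bl c)" and n: "n \<in> {1..r}"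
  shows "block_ratio (\<sigma> n) (C ** B) \<le> block_ratio (\<sigma> n) C + block_ratio n B"
proof (rule block_ratio_le)
  show "\<sigma> n \<in> {1..r}" using \<sigma>(1) n by (simp only: permutes_in_image)
  fix i assume i: "bl i = \<sigma> n"
  let ?M = "block_ratio n B"
  have "C $ i $ s * (B *v x) $ s \<le> exp ?M * (C $ i $ s * x $ s)" for s
  proof (cases "C $ i $ s = 0")
    case False
    then have "\<sigma> (bl s) = \<sigma> n" using \<sigma>(2) i by metis
    then have "bl s = n" using permutes_inj[OF \<sigma>(1)] by (simp add: inj_eq)
    then have "exp (ln ((B *v x) $ s / x $ s)) \<le> exp ?M" using block_ratio_ge by simp
    then have "(B *v x) $ s \<le> exp ?M * x $ s"
      using x_pos[of s] row_mult_pos[OF B x_pos, of s] by (simp add: field_simps)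
    from mult_left_mono[OF this admissible_nonneg[OF C, of i s]] show ?thesis by (simp add: ac_simps)
  qed simp
  then have "(\<Sum>s\<in>UNIV. C $ i $ s * (B *v x) $ s) \<le> exp ?M * (\<Sum>s\<in>UNIV. C $ i $ s * x $ s)"
    unfolding sum_distrib_left by (rule sum_mono)
  then have "(C *v (B *v x)) $ i \<le> exp ?M * (C *v x) $ i"
    by (simp add: matrix_vector_mult_def)
  then have "ln ((C *v (B *v x)) $ i) \<le> ln (exp ?M * (C *v x) $ i)"
    using row_mult_pos[OF C row_mult_pos[OF B x_pos], of i] by simp
  also have "\<dots> = ?M + ln ((C *v x) $ i)"
    using row_mult_pos[OF C x_pos, of i] by (simp add: ln_mult_pos)
  finally have "ln ((C *v (B *v x)) $ i / x $ i) \<le> ?M + ln ((C *v x) $ i / x $ i)"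
    using row_mult_pos[OF C row_mult_pos[OF B x_pos], of i] row_mult_pos[OF C x_pos, of i] x_pos[of i]
    by (simp add: ln_div)
  then show "ln ((C ** B *v x) $ i / x $ i) \<le> block_ratio (\<sigma> n) C + ?M"
    using block_ratio_ge[OF i, of C] by (simp add: matrix_vector_mul_assoc)
qed

text \<open>The nonzero entry identifies the block that \<open>C\<close> sends to the block of
  \<open>s\<close>, so the permutation need not be named.\<close>

lemma expected_block_ratio_mult:
  assumes C: "admissible C" and ne: "C $ s $ c \<noteq> 0"
  shows "E k (\<lambda>B. block_ratio (bl s) (C ** B)) \<le> block_ratio (bl s) C + block_growth k (bl c)"
proof -
  obtain \<sigma> where \<sigma>: "\<sigma> permutes {1..r}" "\<And>i c. C $ i $ c \<noteq> 0 \<Longrightarrow> bl i = \<sigma> (bl c)"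
    using C unfolding admissible_def by metis
  have "E k (\<lambda>B. block_ratio (bl s) (C ** B)) \<le> E k (\<lambda>B. block_ratio (bl c) B + block_ratio (bl s) C)"
  proof (rule E_mono)
    fix B assume "admissible B"
    from block_ratio_mult[OF C this \<sigma> block_range, of c]
    show "block_ratio (bl s) (C ** B) \<le> block_ratio (bl c) B + block_ratio (bl s) C"
      by (simp add: \<sigma>(2)[OF ne] add.commute)
  qed
  then show ?thesis by (simp add: E_add_const block_growth_def add.commute)
qed

lemma expected_block_ratio_mult_le_max:
  assumes C: "admissible C"
  shows "E k (\<lambda>B. block_ratio (bl s) (C ** B)) \<le> block_ratio (bl s) C + max_growth k"
proof -
  obtain c where "0 < row s C $ c" using C semipositive_obtain[of "row s C"] by (auto simp: admissible_def)
  then have "C $ s $ c \<noteq> 0" by (simp add: row_def)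
  from expected_block_ratio_mult[OF C this, of k] show ?thesis
    using block_growth_le_max[OF block_range, of k c] by linarith
qed

text \<open>For rows the conditioning is on the last letters, which form the left factor
  \<open>C\<close>, in contrast to \<open>log_growth_add\<close>.\<close>

lemma block_growth_add: "block_growth (k + l) j = E l (\<lambda>C. E k (\<lambda>B. block_ratio j (C ** B)))"
  unfolding block_growth_def expect_append by (rule expect_swap)

lemma max_growth_subadditive: "max_growth (k + l) \<le> max_growth k + max_growth l"
proof -
  obtain s where s: "max_growth (k + l) = block_growth (k + l) (bl s)" by (rule max_growth_attained)
  have "\<dots> \<le> E l (\<lambda>C. block_ratio (bl s) C + max_growth k)"
    unfolding block_growth_add by (rule E_mono[OF expected_block_ratio_mult_le_max])
  also have "\<dots> = block_growth l (bl s) + max_growth k"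
    by (simp add: E_add_const block_growth_def)
  finally show ?thesis using block_growth_le_max[OF block_range, of l s] s by linarith
qed

text \<open>The maximum principle for one edge, conditioning on the last letter: \<open>d\<close>
  leads to the block of \<open>c\<close>, and every other letter contributes at most
  \<open>max_growth k\<close>. The remaining one-letter costs add up to
  \<open>block_growth 1 (bl s)\<close>.\<close>

lemma block_growth_edge:
  assumes d: "d \<in> {1..m}" and ne: "A d $ s $ c \<noteq> 0"
  shows "block_growth (k + 1) (bl s)
    \<le> p d * block_growth k (bl c) + (1 - p d) * max_growth k + block_growth 1 (bl s)"
proof -
  let ?T = "\<lambda>e. E k (\<lambda>B. block_ratio (bl s) (A e ** B))"
  have rest: "(\<Sum>e\<in>{1..m} - {d}. p e) = 1 - p d"
    using p_sum d by (simp add: sum_diff1)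
  have "block_growth (k + 1) (bl s) = p d * ?T d + (\<Sum>e\<in>{1..m} - {d}. p e * ?T e)"
    unfolding block_growth_add expect_1 by (rule sum.remove) (use d in auto)
  also have "\<dots> \<le> p d * (block_ratio (bl s) (A d) + block_growth k (bl c))
      + (\<Sum>e\<in>{1..m} - {d}. p e * (block_ratio (bl s) (A e) + max_growth k))"
    by (intro add_mono sum_mono mult_left_mono expected_block_ratio_mult[OF _ ne]
        expected_block_ratio_mult_le_max admissible_letter less_imp_le[OF p_pos]) (use d in auto)
  also have "\<dots> = p d * block_growth k (bl c) + (1 - p d) * max_growth k
      + (p d * block_ratio (bl s) (A d) + (\<Sum>e\<in>{1..m} - {d}. p e * block_ratio (bl s) (A e)))"
    by (simp add: distrib_left sum.distrib flip: rest sum_distrib_right)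
  also have "p d * block_ratio (bl s) (A d) + (\<Sum>e\<in>{1..m} - {d}. p e * block_ratio (bl s) (A e))
      = block_growth 1 (bl s)"
    unfolding block_growth_def expect_1 by (rule sum.remove[symmetric]) (use d in auto)
  finally show ?thesis .
qed

text \<open>The extra letter is the first one: it replaces \<open>x\<close> by the positive vector
  \<open>A d *v x\<close>, and the two are comparable against all rows of \<open>B\<close>. This
  undoes the passage to length \<open>k + 1\<close> in \<open>block_growth_edge\<close>.\<close>

lemma block_growth_shift:
  obtains K where "\<And>k s. block_growth k (bl s) \<le> block_growth (k + 1) (bl s) + K"
proof -
  have "\<exists>K. \<forall>z. semipositive z \<longrightarrow> \<bar>ln (x \<bullet> z) - ln ((A d *v x) \<bullet> z)\<bar> \<le> K" if d: "d \<in> {1..m}" for d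
    using ln_inner_comparable[of x "A d *v x", OF x_pos row_mult_pos[OF admissible_letter[OF d] x_pos]]
    by metis
  then obtain K where K: "\<And>d z. d \<in> {1..m} \<Longrightarrow> semipositive z \<Longrightarrow>
      \<bar>ln (x \<bullet> z) - ln ((A d *v x) \<bullet> z)\<bar> \<le> K d"
    by metis
  have ratio: "block_ratio (bl s) B \<le> block_ratio (bl s) (B ** A d) + K d"
    if d: "d \<in> {1..m}" and B: "admissible B" for d B s
  proof (rule block_ratio_le[OF block_range])
    fix i assume i: "bl i = bl s"
    note dx = row_mult_pos[OF admissible_letter[OF d] x_pos]
    have "ln ((B *v x) $ i) - ln ((B *v (A d *v x)) $ i) \<le> K d"
      using K[OF d, of "row i B"] B
      by (auto simp: matrix_vector_component[of B] inner_commute admissible_def)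
    moreover have "0 < (B *v x) $ i" "0 < (B *v (A d *v x)) $ i"
      by (intro row_mult_pos[OF B] x_pos dx)+
    ultimately have "ln ((B *v x) $ i / x $ i) \<le> ln ((B *v (A d *v x)) $ i / x $ i) + K d"
      using x_pos[of i] by (simp add: ln_div)
    then show "ln ((B *v x) $ i / x $ i) \<le> block_ratio (bl s) (B ** A d) + K d"
      using block_ratio_ge[OF i, of "B ** A d"] by (simp add: matrix_vector_mul_assoc)
  qed
  have "block_growth k (bl s) \<le> block_growth (k + 1) (bl s) + (\<Sum>d=1..m. p d * K d)" for k s
  proof -
    have "block_growth k (bl s) = (\<Sum>d=1..m. p d * block_growth k (bl s))"
      by (simp only: p_sum mult_1 flip: sum_distrib_right)
    also have "\<dots> \<le> (\<Sum>d=1..m. p d * (E k (\<lambda>B. block_ratio (bl s) (B ** A d)) + K d))"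
      unfolding block_growth_def E_add_const[symmetric]
      by (intro sum_mono mult_left_mono E_mono ratio less_imp_le[OF p_pos])
    also have "\<dots> = block_growth (k + 1) (bl s) + (\<Sum>d=1..m. p d * K d)"
      by (simp add: block_growth_def expect_Suc distrib_left sum.distrib)
    finally show ?thesis .
  qed
  then show thesis by (rule that)
qed

text \<open>A maximum principle becomes a minimum principle after a change of sign. A nearly maximal
  row \<open>s\<close> forces near maximality at \<open>c\<close>, so propagation follows the edges
  backwards.\<close>

lemma block_growth_lower:
  obtains K where "\<And>k j. j \<in> {1..r} \<Longrightarrow> max_growth k \<le> block_growth k j + K"
proof -
  obtain K1 where K1: "\<And>k s. block_growth k (bl s) \<le> block_growth (k + 1) (bl s) + K1"
    by (rule block_growth_shift) blast
  let ?R = "{(c, s). \<exists>d\<in>{1..m}. A d $ s $ c \<noteq> 0}"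
  have step: "\<exists>\<delta>>0. \<exists>K. \<forall>k. \<delta> * (- block_growth k (bl c)) + (1 - \<delta>) * (- max_growth k) - K
      \<le> - block_growth k (bl s)" if "(s, c) \<in> ?R\<inverse>" for s c
  proof -
    obtain d where d: "d \<in> {1..m}" "A d $ s $ c \<noteq> 0" using \<open>(s, c) \<in> ?R\<inverse>\<close> by blast
    have "p d * (- block_growth k (bl c)) + (1 - p d) * (- max_growth k) - (block_growth 1 (bl s) + K1)
      \<le> - block_growth k (bl s)" for k
      using block_growth_edge[OF d, of k] K1[of k s] by simp
    then show ?thesis using p_pos[OF d(1)] by blast
  qed
  have conn: "(c, s) \<in> (?R\<inverse>)\<^sup>*" for c s
    using connected[of s c] by (simp add: rtrancl_converse)
  have start: "\<exists>c. - block_growth k (bl c) \<le> - max_growth k + 0" for k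
    using max_growth_attained[of k] by (metis add.right_neutral order_refl)
  obtain K where "\<And>k s. - block_growth k (bl s) \<le> - max_growth k + K"
    by (rule minimum_propagation[where h = "\<lambda>k c. - block_growth k (bl c)" and \<mu> = "\<lambda>k. - max_growth k"
          and E = "?R\<inverse>", OF conn step start]) blast+
  then have "max_growth k \<le> block_growth k j + K" if "j \<in> {1..r}" for k j
    using block_nonempty[OF that] by (smt (verit))
  then show thesis by (rule that)
qed

text \<open>On block \<open>\<sigma> n\<close>, the vectors \<open>B *v x\<close> and
  \<open>B *v block_indicator n\<close> are comparable, because the relevant rows see only block
  \<open>n\<close>. Passing between a maximum of rows and a sum weighted by \<open>v\<close> costs
  constants independent of \<open>B\<close>.\<close>

lemma block_ratio_indicator:
  obtains K where "\<And>B \<sigma> n. admissible B \<Longrightarrow> \<sigma> permutes {1..r} \<Longrightarrow>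
    (\<And>i c. B $ i $ c \<noteq> 0 \<Longrightarrow> bl i = \<sigma> (bl c)) \<Longrightarrow> n \<in> {1..r} \<Longrightarrow>
    \<bar>block_ratio (\<sigma> n) B - ln (v \<bullet> (B *v block_indicator n))\<bar> \<le> K"
proof -
  let ?one = "(\<chi> i. 1) :: real ^ 'n"
  obtain K0 where K0: "\<And>z. semipositive z \<Longrightarrow> \<bar>ln (x \<bullet> z) - ln (?one \<bullet> z)\<bar> \<le> K0"
    by (rule ln_inner_comparable[of x ?one]) (auto simp: x_pos)
  define Kv where "Kv = (\<Sum>i\<in>UNIV. \<bar>ln (v $ i)\<bar>)"
  define Kx where "Kx = (\<Sum>i\<in>UNIV. \<bar>ln (x $ i)\<bar>)"
  define V where "V = (\<Sum>i\<in>UNIV. v $ i)"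
  have Kv: "\<bar>ln (v $ i)\<bar> \<le> Kv" and Kx: "\<bar>ln (x $ i)\<bar> \<le> Kx" for i
    unfolding Kv_def Kx_def by (rule member_le_sum; simp)+
  have V: "0 < V" unfolding V_def by (rule sum_pos) (auto simp: v_pos)
  have "\<bar>block_ratio (\<sigma> n) B - ln (v \<bullet> (B *v block_indicator n))\<bar> \<le> K0 + Kv + Kx + \<bar>ln V\<bar>"
    if B: "admissible B" and \<sigma>: "\<sigma> permutes {1..r}"
      and bl\<sigma>: "\<And>i c. B $ i $ c \<noteq> 0 \<Longrightarrow> bl i = \<sigma> (bl c)" and n: "n \<in> {1..r}" for B \<sigma> n
  proof -
    let ?y = "B *v block_indicator n" and ?M = "block_ratio (\<sigma> n) B"
    have y: "semipositive ?y"
      by (intro admissible_mult_vector[OF B] block_vector_semipositive block_vector_indicator n)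
    note Y = weight_pos[OF y]
    \<comment> \<open>A row in block \<open>\<sigma> n\<close> is supported on block
      \<open>n\<close>, so pairing it with the indicator gives the full row sum.\<close>
    have same: "?y $ i = ?one \<bullet> row i B" if i: "bl i = \<sigma> n" for i
    proof -
      have "bl c = n" if "B $ i $ c \<noteq> 0" for c
        using bl\<sigma>[OF that] i permutes_inj[OF \<sigma>] by (simp add: inj_eq)
      then have "(\<Sum>c\<in>UNIV. B $ i $ c * block_indicator n $ c) = (\<Sum>c\<in>UNIV. B $ i $ c)"
        by (intro sum.cong) (auto simp: block_indicator_def)
      then show ?thesis by (simp add: matrix_vector_mult_def inner_vec_def row_def)
    qed
    have row: "semipositive (row i B)" for i using B by (simp add: admissible_def)
    have close: "\<bar>ln ((B *v x) $ i) - ln (?y $ i)\<bar> \<le> K0" and y_pos: "0 < ?y $ i" if i: "bl i = \<sigma> n" for i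
      using K0[OF row] inner_semipositive_pos[OF _ row, of ?one i]
      unfolding same[OF i] by (simp_all add: matrix_vector_component inner_commute)
    have upper: "?M \<le> ln (v \<bullet> ?y) + (K0 + Kv + Kx)"
    proof (rule block_ratio_le)
      show "\<sigma> n \<in> {1..r}" using \<sigma> n by (simp only: permutes_in_image)
      fix i assume i: "bl i = \<sigma> n"
      have "v $ i * ?y $ i \<le> v \<bullet> ?y"
        unfolding inner_vec_def inner_real_def
        by (rule member_le_sum) (auto intro!: mult_nonneg_nonneg less_imp_le[OF v_pos] semipositive_nonneg[OF y])
      then have "ln (v $ i * ?y $ i) \<le> ln (v \<bullet> ?y)" using y_pos[OF i] v_pos[of i] Y by simp
      then have "ln (v $ i) + ln (?y $ i) \<le> ln (v \<bullet> ?y)"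
        using y_pos[OF i] v_pos[of i] by (simp add: ln_mult_pos)
      then show "ln ((B *v x) $ i / x $ i) \<le> ln (v \<bullet> ?y) + (K0 + Kv + Kx)"
        using close[OF i] Kv[of i] Kx[of i] x_pos[of i] row_mult_pos[OF B x_pos, of i] by (simp add: ln_div)
    qed
    \<comment> \<open>For the reverse inequality each coordinate of \<open>?y\<close> is bounded by
      the block maximum or vanishes outside the block; summation produces the factor
      \<open>V\<close>.\<close>
    have "v $ i * ?y $ i \<le> v $ i * exp (?M + K0 + Kx)" for i
    proof (rule mult_left_mono)
      show "?y $ i \<le> exp (?M + K0 + Kx)"
      proof (cases "bl i = \<sigma> n")
        case True
        have "ln (?y $ i) \<le> ?M + K0 + Kx"
          using block_ratio_ge[OF True, of B] close[OF True] Kx[of i] x_pos[of i] row_mult_pos[OF B x_pos, of i]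
          by (simp add: ln_div)
        then show ?thesis using y_pos[OF True] by (metis exp_le_cancel_iff exp_ln)
      next
        case False
        have "?y $ i = 0"
        proof (rule ccontr)
          assume "?y $ i \<noteq> 0"
          then obtain c where "B $ i $ c \<noteq> 0" "block_indicator n $ c \<noteq> 0" by (rule matrix_vector_nonzeroE)
          then show False using bl\<sigma>[of i c] False by (auto simp: block_indicator_def split: if_splits)
        qed
        then show ?thesis by simp
      qed
    qed (rule less_imp_le[OF v_pos])
    then have "v \<bullet> ?y \<le> V * exp (?M + K0 + Kx)"
      unfolding inner_vec_def V_def sum_distrib_right inner_real_def by (intro sum_mono)
    then have "ln (v \<bullet> ?y) \<le> ln (V * exp (?M + K0 + Kx))" using Y by simp
    then have "ln (v \<bullet> ?y) \<le> ln V + (?M + K0 + Kx)" using V by (simp add: ln_mult_pos)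
    moreover have "0 \<le> Kv" by (simp add: Kv_def sum_nonneg)
    ultimately show ?thesis using upper by linarith
  qed
  then show thesis by (rule that) 
qed

text \<open>The row growths of all blocks agree with \<open>max_growth\<close> up to a constant.
  Their sum agrees with the sum of the growths of the block indicators, which is \<open>r\<close>
  times \<open>real k * L\<close> up to a constant.\<close>

lemma max_growth_rate:
  assumes "\<And>k y. block_vector y \<Longrightarrow> \<bar>log_growth k y - ln (v \<bullet> y) - real k * L\<bar> \<le> K"
  obtains K' where "\<And>k. \<bar>max_growth k - real k * L\<bar> \<le> K'"
proof -
  obtain K1 where K1: "\<And>k j. j \<in> {1..r} \<Longrightarrow> max_growth k \<le> block_growth k j + K1"
    by (rule block_growth_lower) blast
  obtain K2 where K2: "\<And>B \<sigma> n. admissible B \<Longrightarrow> \<sigma> permutes {1..r} \<Longrightarrow>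
    (\<And>i c. B $ i $ c \<noteq> 0 \<Longrightarrow> bl i = \<sigma> (bl c)) \<Longrightarrow> n \<in> {1..r} \<Longrightarrow>
    \<bar>block_ratio (\<sigma> n) B - ln (v \<bullet> (B *v block_indicator n))\<bar> \<le> K2"
    by (rule block_ratio_indicator) blast
  let ?K3 = "\<Sum>n=1..r. \<bar>ln (v \<bullet> block_indicator n)\<bar>"
  have ratios: "\<bar>(\<Sum>j=1..r. block_ratio j B) - (\<Sum>n=1..r. ln (v \<bullet> (B *v block_indicator n)))\<bar> \<le> real r * K2"
    if B: "admissible B" for B
  proof -
    obtain \<sigma> where \<sigma>: "\<sigma> permutes {1..r}" "\<And>i c. B $ i $ c \<noteq> 0 \<Longrightarrow> bl i = \<sigma> (bl c)"
      using B unfolding admissible_def by metis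
    \<comment> \<open>The permutation depends on \<open>B\<close>, but summing over all blocks makes
      it disappear after reindexing.\<close>
    have "(\<Sum>j=1..r. block_ratio j B) - (\<Sum>n=1..r. ln (v \<bullet> (B *v block_indicator n)))
        = (\<Sum>n=1..r. block_ratio (\<sigma> n) B - ln (v \<bullet> (B *v block_indicator n)))"
      using sum.permute[OF \<sigma>(1), of "\<lambda>j. block_ratio j B"] by (simp add: sum_subtractf o_def)
    also have "\<bar>\<dots>\<bar> \<le> (\<Sum>n=1..r. K2)"
      by (rule order.trans[OF sum_abs], rule sum_mono) (rule K2[OF B \<sigma>])
    finally show ?thesis by simp
  qed
  have total: "\<bar>(\<Sum>j=1..r. block_growth k j) - (\<Sum>n=1..r. log_growth k (block_indicator n))\<bar> \<le> real r * K2" for k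
  proof -
    have "\<bar>(\<Sum>j=1..r. block_growth k j) - (\<Sum>n=1..r. log_growth k (block_indicator n))\<bar>
        = \<bar>E k (\<lambda>B. (\<Sum>j=1..r. block_ratio j B) - (\<Sum>n=1..r. ln (v \<bullet> (B *v block_indicator n))))\<bar>"
      by (simp add: expect_diff expect_sum block_growth_def log_growth_def)
    also have "\<dots> \<le> E k (\<lambda>B. real r * K2)"
      by (rule order.trans[OF E_abs], rule E_mono) (rule ratios)
    finally show ?thesis by (simp add: E_const)
  qed
  have logs: "\<bar>(\<Sum>n=1..r. log_growth k (block_indicator n)) - real r * (real k * L)\<bar> \<le> real r * K + ?K3" for k
  proof -
    have "(\<Sum>n=1..r. log_growth k (block_indicator n)) - real r * (real k * L)
        = (\<Sum>n=1..r. log_growth k (block_indicator n) - real k * L)"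
      by (simp add: sum_subtractf)
    also have "\<bar>\<dots>\<bar> \<le> (\<Sum>n=1..r. K + \<bar>ln (v \<bullet> block_indicator n)\<bar>)"
      by (rule order.trans[OF sum_abs], rule sum_mono)
        (use assms[OF block_vector_indicator, of _ k] in \<open>smt (verit)\<close>)
    finally show ?thesis by (simp add: sum.distrib)
  qed
  have "\<bar>max_growth k - real k * L\<bar> \<le> K1 + K2 + K + ?K3" for k
  proof -
    have "(\<Sum>j=1..r. block_growth k j) \<le> (\<Sum>j=1..r. max_growth k)"
      by (intro sum_mono block_growth_le_max)
    moreover have "(\<Sum>j=1..r. max_growth k) \<le> (\<Sum>j=1..r. block_growth k j + K1)"
      by (intro sum_mono K1)
    moreover have "real r * \<bar>max_growth k - real k * L\<bar> = \<bar>real r * max_growth k - real r * (real k * L)\<bar>"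
      by (simp add: abs_mult flip: right_diff_distrib)
    ultimately have "real r * \<bar>max_growth k - real k * L\<bar> \<le> real r * K1 + real r * K2 + real r * K + ?K3"
      using total[of k] logs[of k]
      by (simp only: sum.distrib sum_constant card_atLeastAtMost diff_Suc_1)
    \<comment> \<open>Enlarging \<open>?K3\<close> by the factor \<open>r\<close> makes every error
      term a multiple of \<open>r\<close>, which can then be cancelled.\<close>
    moreover have "?K3 \<le> real r * ?K3"
      using r_pos mult_right_mono[of 1 "real r" ?K3] by (simp add: sum_nonneg)
    ultimately have "real r * \<bar>max_growth k - real k * L\<bar> \<le> real r * (K1 + K2 + K + ?K3)"
      by (simp add: algebra_simps)
    then show ?thesis using r_pos by simp
  qed
  then show thesis by (rule that)
qed

text \<open>Subadditivity removes the error: a deficit at length \<open>k\<close> would be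
  multiplied by \<open>n\<close> at length \<open>n * k\<close> and eventually exceed
  \<open>K\<close>.\<close>

lemma max_growth_ge_rate:
  assumes "\<And>k. \<bar>max_growth k - real k * L\<bar> \<le> K"
  shows "real k * L \<le> max_growth k"
proof (rule ccontr)
  assume "\<not> ?thesis"
  then have gap: "0 < real k * L - max_growth k" by simp
  obtain n where n: "K / (real k * L - max_growth k) < real n" using reals_Archimedean2 by blast
  have "0 \<le> K" using assms[of 0] by linarith
  then have "0 \<le> K / (real k * L - max_growth k)" using gap by simp
  with n have "1 \<le> n" by (cases n) auto
  have "K < real n * (real k * L - max_growth k)" using n gap by (simp add: field_simps)
  moreover have "real (n * k) * L - K \<le> real n * max_growth k"
    using subadditive_multiple[of max_growth n k, OF max_growth_subadditive \<open>1 \<le> n\<close>] assms[of "n * k"]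
    by linarith
  ultimately show False by (simp add: algebra_simps)
qed

section \<open>Fluctuations and the Lyapunov exponent\<close>

text \<open>Conditioning on the first letter splits the deviation into a bounded increment
  \<open>e\<close> and the deviation \<open>?z\<close> started from \<open>A d *v y\<close>. Since
  the mean of \<open>?z\<close> is bounded, each letter adds at most \<open>C\<close> to the second
  moment.\<close>

lemma log_growth_second_moment:
  assumes rate: "\<And>k y. block_vector y \<Longrightarrow> \<bar>log_growth k y - ln (v \<bullet> y) - real k * L\<bar> \<le> K"
  obtains C where "\<And>k y. block_vector y \<Longrightarrow>
    E k (\<lambda>B. (ln (v \<bullet> (B *v y)) - ln (v \<bullet> y) - real k * L)\<^sup>2) \<le> C * real k"
proof -
  obtain K1 where K1: "0 \<le> K1" "\<And>d z. d \<in> {1..m} \<Longrightarrow> semipositive z \<Longrightarrow>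
      \<bar>ln (v \<bullet> (A d *v z)) - ln (v \<bullet> z)\<bar> \<le> K1"
    by (rule log_weight_letter_step) blast
  define M where "M = K1 + \<bar>L\<bar>"
  define C where "C = 2 * (M * K) + M\<^sup>2"
  have "E k (\<lambda>B. (ln (v \<bullet> (B *v y)) - ln (v \<bullet> y) - real k * L)\<^sup>2) \<le> C * real k"
    if y: "block_vector y" for k y
    using y
  proof (induction k arbitrary: y)
    case 0
    then show ?case by (simp add: expect_0)
  next
    case (Suc k)
    have letter: "E k (\<lambda>B. (ln (v \<bullet> (B *v (A d *v y))) - ln (v \<bullet> y) - real (Suc k) * L)\<^sup>2) \<le> C * real k + C"
      if d: "d \<in> {1..m}" for d
    proof -
      let ?y = "A d *v y"
      let ?z = "\<lambda>B. ln (v \<bullet> (B *v ?y)) - ln (v \<bullet> ?y) - real k * L"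
      define e where "e = ln (v \<bullet> ?y) - ln (v \<bullet> y) - L"
      have yb: "block_vector ?y" by (rule block_vector_mult[OF admissible_letter[OF d] Suc.prems])
      have e: "\<bar>e\<bar> \<le> M"
        using K1(2)[OF d block_vector_semipositive[OF Suc.prems]] by (simp add: e_def M_def)
      have Ez: "E k ?z = log_growth k ?y - ln (v \<bullet> ?y) - real k * L"
        by (simp add: expect_diff E_const log_growth_def)
      have "E k (\<lambda>B. (ln (v \<bullet> (B *v ?y)) - ln (v \<bullet> y) - real (Suc k) * L)\<^sup>2)
          = E k (\<lambda>B. (?z B)\<^sup>2 + (2 * e) * ?z B + e\<^sup>2)"
        by (rule E_cong) (simp add: e_def power2_eq_square algebra_simps)
      also have "\<dots> = E k (\<lambda>B. (?z B)\<^sup>2) + (2 * e) * E k ?z + e\<^sup>2"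
        by (simp only: expect_add expect_cmult E_const)
      also have "\<dots> \<le> C * real k + 2 * (M * K) + M\<^sup>2"
      proof (intro add_mono)
        show "E k (\<lambda>B. (?z B)\<^sup>2) \<le> C * real k" by (rule Suc.IH[OF yb])
        \<comment> \<open>The almost-martingale property enters here: the mean is bounded by
          \<open>K\<close> uniformly in \<open>k\<close>, so the cross term does not grow.\<close>
        have "\<bar>e * E k ?z\<bar> \<le> M * K"
          unfolding abs_mult Ez by (intro mult_mono e rate yb) (use e in auto)
        then show "(2 * e) * E k ?z \<le> 2 * (M * K)" by linarith
        show "e\<^sup>2 \<le> M\<^sup>2" using e by (simp add: abs_le_square_iff[symmetric])
      qed
      finally show ?thesis by (simp add: C_def)
    qed
    have "E (Suc k) (\<lambda>B. (ln (v \<bullet> (B *v y)) - ln (v \<bullet> y) - real (Suc k) * L)\<^sup>2)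
        \<le> (\<Sum>d=1..m. p d * (C * real k + C))"
      unfolding expect_Suc matrix_vector_mul_assoc[symmetric]
      by (intro sum_mono mult_left_mono letter less_imp_le[OF p_pos])
    also have "\<dots> = C * real (Suc k)"
      by (simp only: p_sum flip: sum_distrib_right) (simp add: algebra_simps)
    finally show ?case .
  qed
  then show thesis by (rule that)
qed

text \<open>By Cauchy-Schwarz, the weight of a single column of \<open>B\<close> is at most
  \<open>norm v\<close> times the operator norm.\<close>

lemma expected_log_norm_lower:
  assumes rate: "\<And>k y. block_vector y \<Longrightarrow> \<bar>log_growth k y - ln (v \<bullet> y) - real k * L\<bar> \<le> K"
  obtains K' where "\<And>k. real k * L - K' \<le> E k (\<lambda>B. ln (onorm ((*v) B)))"
proof -
  let ?e = "axis undefined 1 :: real ^ 'n"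
  have norm_v: "0 < norm v" using v_pos[of undefined] by auto
  have "real k * L - (K - ln (v \<bullet> ?e) + ln (norm v)) \<le> E k (\<lambda>B. ln (onorm ((*v) B)))" for k
  proof -
    have "log_growth k ?e \<le> E k (\<lambda>B. ln (onorm ((*v) B)) + ln (norm v))"
      unfolding log_growth_def
    proof (rule E_mono)
      fix B assume B: "admissible B"
      have "norm (B *v ?e) \<le> onorm ((*v) B) * norm ?e"
        by (rule onorm[OF matrix_vector_mul_bounded_linear])
      then have "norm (B *v ?e) \<le> onorm ((*v) B)" by simp
      then have "v \<bullet> (B *v ?e) \<le> onorm ((*v) B) * norm v"
        using norm_cauchy_schwarz[of v "B *v ?e"] mult_right_mono[of "norm (B *v ?e)" "onorm ((*v) B)" "norm v"]
        by (simp add: mult.commute)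
      moreover have pos: "0 < v \<bullet> (B *v ?e)" by (rule weight_mult_pos[OF B semipositive_axis])
      ultimately have "ln (v \<bullet> (B *v ?e)) \<le> ln (onorm ((*v) B) * norm v)"
        and "0 < onorm ((*v) B) * norm v" by auto
      then show "ln (v \<bullet> (B *v ?e)) \<le> ln (onorm ((*v) B)) + ln (norm v)"
        using norm_v by (simp add: ln_mult_pos zero_less_mult_iff)
    qed
    then show ?thesis using rate[OF block_vector_axis, of k undefined] by (simp add: E_add_const)
  qed
  then show thesis by (rule that)
qed

text \<open>The norm is controlled by the largest column weight, whose logarithm exceeds
  \<open>real k * L\<close> by at most the sum of the absolute deviations of all columns, up to a
  constant. Each of these has mean of order \<open>sqrt (real k)\<close> by the second moment
  bound.\<close>

lemma expected_log_norm_upper: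
  assumes rate: "\<And>k y. block_vector y \<Longrightarrow> \<bar>log_growth k y - ln (v \<bullet> y) - real k * L\<bar> \<le> K"
  obtains K' where "\<And>k. k \<ge> 1 \<Longrightarrow> E k (\<lambda>B. ln (onorm ((*v) B))) \<le> real k * L + K' + K' * sqrt (real k)"
proof -
  obtain C where C: "\<And>k y. block_vector y \<Longrightarrow>
    E k (\<lambda>B. (ln (v \<bullet> (B *v y)) - ln (v \<bullet> y) - real k * L)\<^sup>2) \<le> C * real k"
    using log_growth_second_moment[OF rate] by blast
  define Kv where "Kv = (\<Sum>i\<in>UNIV. \<bar>ln (v $ i)\<bar>)"
  have Kv: "\<bar>ln (v $ i)\<bar> \<le> Kv" for i
    unfolding Kv_def by (rule member_le_sum; simp)
  let ?N = "real CARD('n)"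
  have N: "0 < ?N" by simp
  let ?K1 = "ln (?N * ?N) + 2 * Kv" and ?K2 = "?N * (C + 1) / 2"
  have bound: "E k (\<lambda>B. ln (onorm ((*v) B))) \<le> real k * L + ?K1 + ?K2 * sqrt (real k)" if k: "k \<ge> 1" for k
  proof -
    define z where "z c B = ln (v \<bullet> (B *v axis c 1)) - ln (v \<bullet> axis c 1) - real k * L" for c B
    define s where "s = sqrt (real k)"
    have s: "0 < s" "s * s = real k" using k by (auto simp: s_def)
    have mean: "E k (\<lambda>B. \<bar>z c B\<bar>) \<le> (C + 1) / 2 * s" for c
    proof -
      \<comment> \<open>The arithmetic-geometric inequality at scale \<open>s\<close> replaces
        Cauchy-Schwarz in passing from the second moment to the first.\<close>
      have "E k (\<lambda>B. \<bar>z c B\<bar>) \<le> E k (\<lambda>B. 1 / (2 * s) * (z c B)\<^sup>2 + s / 2)"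
      proof (rule E_mono)
        fix B
        have "0 \<le> (\<bar>z c B\<bar> - s)\<^sup>2" by simp
        then have "2 * s * \<bar>z c B\<bar> \<le> (z c B)\<^sup>2 + s * s" by (simp add: power2_eq_square algebra_simps)
        then show "\<bar>z c B\<bar> \<le> 1 / (2 * s) * (z c B)\<^sup>2 + s / 2" using s by (simp add: field_simps)
      qed
      also have "\<dots> = 1 / (2 * s) * E k (\<lambda>B. (z c B)\<^sup>2) + s / 2"
        by (simp only: E_add_const expect_cmult)
      also have "\<dots> \<le> 1 / (2 * s) * (C * (s * s)) + s / 2"
        using C[OF block_vector_axis, of k c] s unfolding z_def
        by (intro add_right_mono mult_left_mono) auto
      also have "\<dots> = (C + 1) / 2 * s" using s(1) by (simp add: field_simps)
      finally show ?thesis .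
    qed
    have "E k (\<lambda>B. ln (onorm ((*v) B))) \<le> E k (\<lambda>B. (\<Sum>c\<in>UNIV. \<bar>z c B\<bar>) + (?K1 + real k * L))"
    proof (rule E_mono)
      fix B assume B: "admissible B"
      let ?S = "\<Sum>c\<in>UNIV. \<bar>z c B\<bar>"
      \<comment> \<open>One \<open>Kv\<close> accounts for the initial weight of the column, the
        other for dividing by \<open>v $ i\<close>.\<close>
      let ?b = "exp (2 * Kv + real k * L + ?S)"
      have "\<bar>B $ i $ c\<bar> \<le> ?b" for i c
      proof -
        have pos: "0 < v \<bullet> (B *v axis c 1)" by (rule weight_mult_pos[OF B semipositive_axis])
        have "\<bar>z c B\<bar> \<le> ?S" by (rule member_le_sum) auto
        then have "z c B \<le> ?S" by linarith
        moreover have "ln (v \<bullet> axis c 1) \<le> Kv"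
          using Kv[of c] by (simp add: inner_axis)
        ultimately have "ln (v \<bullet> (B *v axis c 1)) \<le> Kv + real k * L + ?S" by (simp add: z_def)
        then have 1: "v \<bullet> (B *v axis c 1) \<le> exp (Kv + real k * L + ?S)"
          using pos by (metis exp_le_cancel_iff exp_ln)
        have "v $ i * B $ i $ c \<le> (\<Sum>i\<in>UNIV. v $ i * B $ i $ c)"
          by (rule member_le_sum)
            (auto intro!: mult_nonneg_nonneg less_imp_le[OF v_pos] admissible_nonneg[OF B])
        also have "\<dots> = v \<bullet> (B *v axis c 1)"
          by (simp add: matrix_vector_mult_basis inner_vec_def column_def)
        finally have 2: "v $ i * B $ i $ c \<le> exp (Kv + real k * L + ?S)" using 1 by linarith
        have "exp (- Kv) \<le> exp (ln (v $ i))" using Kv[of i] by simp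
        then have "exp (- Kv) * B $ i $ c \<le> v $ i * B $ i $ c"
          using v_pos[of i] by (intro mult_right_mono admissible_nonneg[OF B]) simp
        with 2 have "exp (- Kv) * B $ i $ c \<le> exp (Kv + real k * L + ?S)" by linarith
        then have "exp Kv * (exp (- Kv) * B $ i $ c) \<le> exp Kv * exp (Kv + real k * L + ?S)"
          by (intro mult_left_mono) auto
        then have "B $ i $ c \<le> ?b"
          by (simp add: mult.assoc[symmetric] exp_add[symmetric] add.assoc[symmetric])
        then show ?thesis using admissible_nonneg[OF B, of i c] by simp
      qed
      then have "onorm ((*v) B) \<le> ?N * ?N * ?b"
        by (rule onorm_le_matrix_component)
      moreover have "0 < onorm ((*v) B)"
      proof -
        have "B *v axis undefined 1 \<noteq> 0"
          using admissible_mult_vector[OF B semipositive_axis, of undefined] by (simp only: semipositive_def) simp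
        then show ?thesis
          by (subst onorm_pos_lt[OF matrix_vector_mul_bounded_linear]) auto
      qed
      ultimately have "ln (onorm ((*v) B)) \<le> ln (?N * ?N * ?b)" by simp
      also have "\<dots> = ln (?N * ?N) + (2 * Kv + real k * L + ?S)"
        by (subst ln_mult_pos) auto
      finally show "ln (onorm ((*v) B)) \<le> ?S + (?K1 + real k * L)" by simp
    qed
    also have "\<dots> = (\<Sum>c\<in>UNIV. E k (\<lambda>B. \<bar>z c B\<bar>)) + (?K1 + real k * L)"
      by (simp only: E_add_const expect_sum)
    also have "\<dots> \<le> (\<Sum>c\<in>(UNIV :: 'n set). (C + 1) / 2 * s) + (?K1 + real k * L)"
      by (intro add_right_mono sum_mono mean)
    finally show ?thesis by (simp add: s_def algebra_simps)
  qed
  show thesis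
  proof (rule that[of "\<bar>?K1\<bar> + \<bar>?K2\<bar>"])
    fix k :: nat assume k: "k \<ge> 1"
    have "?K2 * sqrt (real k) \<le> (\<bar>?K1\<bar> + \<bar>?K2\<bar>) * sqrt (real k)"
      by (rule mult_right_mono) (linarith, simp)
    then show "E k (\<lambda>B. ln (onorm ((*v) B))) \<le> real k * L + (\<bar>?K1\<bar> + \<bar>?K2\<bar>) + (\<bar>?K1\<bar> + \<bar>?K2\<bar>) * sqrt (real k)"
      using bound[OF k] by linarith
  qed
qed

text \<open>After division by \<open>k\<close> the square-root error vanishes. The sandwich shows
  that the sequence converges, so \<open>lim\<close> denotes a genuine limit.\<close>

lemma lyapunov_exponent_eq_rate:
  assumes rate: "\<And>k y. block_vector y \<Longrightarrow> \<bar>log_growth k y - ln (v \<bullet> y) - real k * L\<bar> \<le> K"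
  shows "lyapunov_exponent m p A = L"
proof -
  obtain K1 where K1: "\<And>k. real k * L - K1 \<le> E k (\<lambda>B. ln (onorm ((*v) B)))"
    using expected_log_norm_lower[OF rate] by blast
  obtain K2 where K2: "\<And>k. k \<ge> 1 \<Longrightarrow> E k (\<lambda>B. ln (onorm ((*v) B))) \<le> real k * L + K2 + K2 * sqrt (real k)"
    using expected_log_norm_upper[OF rate] by blast
  have "(\<lambda>k. (1 / real k) * E k (\<lambda>B. ln (onorm ((*v) B)))) \<longlonglongrightarrow> L"
  proof (rule tendsto_sandwich)
    show "\<forall>\<^sub>F k in sequentially. L - K1 / real k \<le> (1 / real k) * E k (\<lambda>B. ln (onorm ((*v) B)))"
      using eventually_ge_at_top[of 1]
    proof eventually_elim
      case (elim k)
      have "L - K1 / real k = (1 / real k) * (real k * L - K1)" using elim by (simp add: field_simps)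
      also have "\<dots> \<le> (1 / real k) * E k (\<lambda>B. ln (onorm ((*v) B)))" by (intro mult_left_mono K1) simp
      finally show ?case .
    qed
    show "\<forall>\<^sub>F k in sequentially. (1 / real k) * E k (\<lambda>B. ln (onorm ((*v) B)))
        \<le> L + K2 / real k + K2 / sqrt (real k)"
      using eventually_ge_at_top[of 1]
    proof eventually_elim
      case (elim k)
      have "(1 / real k) * E k (\<lambda>B. ln (onorm ((*v) B))) \<le> (1 / real k) * (real k * L + K2 + K2 * sqrt (real k))"
        by (intro mult_left_mono K2 elim) simp
      also have "\<dots> = L + K2 / real k + K2 * (sqrt (real k) / real k)"
        using elim by (simp add: field_simps)
      also have "sqrt (real k) / real k = 1 / sqrt (real k)"
        using sqrt_divide_self_eq[of "real k"] by (simp add: inverse_eq_divide)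
      finally show ?case by simp
    qed
    show "(\<lambda>k. L - K1 / real k) \<longlonglongrightarrow> L"
      using tendsto_diff[OF tendsto_const lim_const_over_n] by simp
    have "filterlim (\<lambda>k. sqrt (real k)) at_top sequentially"
      by (rule filterlim_compose[OF sqrt_at_top filterlim_real_sequentially])
    then have "(\<lambda>k. K2 / sqrt (real k)) \<longlonglongrightarrow> 0"
      by (rule real_tendsto_divide_at_top[OF tendsto_const])
    then show "(\<lambda>k. L + K2 / real k + K2 / sqrt (real k)) \<longlonglongrightarrow> L"
      using tendsto_add[OF tendsto_add[OF tendsto_const lim_const_over_n]] by fastforce
  qed
  then show ?thesis unfolding lyapunov_exponent_def by (rule limI)
qed

lemma beta_eq: "beta m p A k v = column_growth k / real k"
  by (simp add: beta_def column_growth_def log_growth_def matrix_vector_mult_basis)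

text \<open>Superadditivity and subadditivity give the two one-sided bounds without error. Both
  growth sequences stay within a constant of \<open>real k * L\<close>, which gives the gap of order
  \<open>inverse (real k)\<close>.\<close>

theorem growth_bounds:
  obtains C where
    "\<And>k. k \<ge> 1 \<Longrightarrow> beta m p A k v \<le> lyapunov_exponent m p A"
    "\<And>k. k \<ge> 1 \<Longrightarrow> lyapunov_exponent m p A \<le> max_growth k / real k"
    "\<And>k. k \<ge> 1 \<Longrightarrow> max_growth k / real k - beta m p A k v \<le> C * inverse (real k)"
proof -
  obtain L K where L: "\<And>k. k \<ge> 1 \<Longrightarrow> column_growth k \<le> real k * L"
      "\<And>k. k \<ge> 1 \<Longrightarrow> real k * L \<le> column_growth k + K"
    and rate: "\<And>k y. block_vector y \<Longrightarrow> \<bar>log_growth k y - ln (v \<bullet> y) - real k * L\<bar> \<le> K"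
    by (rule growth_rate) blast
  obtain K' where K': "\<And>k. \<bar>max_growth k - real k * L\<bar> \<le> K'"
    using max_growth_rate[OF rate] by blast
  note lyap = lyapunov_exponent_eq_rate[OF rate]
  show thesis
  proof (rule that[of "K + K'"])
    fix k :: nat assume k: "k \<ge> 1"
    then show "beta m p A k v \<le> lyapunov_exponent m p A"
      using L(1)[OF k] by (simp add: lyap beta_eq field_simps)
    show "lyapunov_exponent m p A \<le> max_growth k / real k"
      using max_growth_ge_rate[OF K', of k] k by (simp add: lyap field_simps)
    show "max_growth k / real k - beta m p A k v \<le> (K + K') * inverse (real k)"
    proof -
      have "max_growth k - column_growth k \<le> K + K'" using L(2)[OF k] K'[of k] by linarith
      then have "(max_growth k - column_growth k) / real k \<le> (K + K') / real k"
        by (rule divide_right_mono) simp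
      then show ?thesis by (simp add: beta_eq left_diff_distrib divide_inverse)
    qed
  qed
qed

end

section \<open>From invariant subspaces and cones to zero patterns\<close>

lemma coord_subspace_eq: "coord_subspace S = {u :: real ^ 'n::finite. \<forall>i. i \<notin> S \<longrightarrow> u $ i = 0}"
proof -
  have "span ((\<lambda>i. axis i (1::real)) ` S) = {u. \<forall>b\<in>Basis. b \<notin> (\<lambda>i. axis i 1) ` S \<longrightarrow> u \<bullet> b = 0}"
    by (rule span_substd_basis) (auto simp: Basis_vec_def)
  also have "\<dots> = {u :: real ^ 'n. \<forall>i. i \<notin> S \<longrightarrow> u $ i = 0}"
    by (auto simp: Basis_vec_def inner_axis axis_eq_axis image_iff)
  finally show ?thesis by (simp add: coord_subspace_def)
qed

text \<open>If \<open>s\<close> were unreachable from \<open>c\<close>, the indices reachable from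
  \<open>c\<close> would span an invariant coordinate subspace containing the basis vector at
  \<open>c\<close> but not the one at \<open>s\<close>.\<close>

lemma irreducible_connected:
  fixes A :: "('n::finite) family"
  assumes irr: "\<not> reducible_family m A"
  shows "(c, s) \<in> {(c, s). \<exists>d\<in>{1..m}. A d $ s $ c \<noteq> 0}\<^sup>*" (is "_ \<in> ?R\<^sup>*")
proof (rule ccontr)
  assume s: "(c, s) \<notin> ?R\<^sup>*"
  define S where "S = {t. (c, t) \<in> ?R\<^sup>*}"
  have "c \<in> S" "s \<notin> S" using s by (auto simp: S_def)
  then have "axis c 1 \<in> coord_subspace S" "axis s 1 \<notin> coord_subspace S"
    by (auto simp: coord_subspace_eq axis_def)
  moreover have "axis c (1::real) \<noteq> 0" by (simp add: axis_eq_0_iff)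
  ultimately have "coord_subspace S \<noteq> {0}" "coord_subspace S \<noteq> UNIV" by blast+
  moreover have "A d *v u \<in> coord_subspace S" if d: "d \<in> {1..m}" and u: "u \<in> coord_subspace S" for d u
    unfolding coord_subspace_eq
  proof (intro CollectI allI impI)
    fix i assume i: "i \<notin> S"
    show "(A d *v u) $ i = 0"
    proof (rule ccontr)
      assume "(A d *v u) $ i \<noteq> 0"
      then obtain t where t: "A d $ i $ t \<noteq> 0" "u $ t \<noteq> 0" by (rule matrix_vector_nonzeroE)
      have "t \<in> S" using u t(2) by (auto simp: coord_subspace_eq)
      moreover have "(t, i) \<in> ?R" using d t(1) by blast
      ultimately have "i \<in> S" unfolding S_def by (simp add: rtrancl.rtrancl_into_rtrancl)
      with i show False by simp
    qed
  qed
  ultimately show False using irr unfolding reducible_family_def by blast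
qed

text \<open>Applied to images of basis vectors, this turns the cone inclusions into the zero pattern
  of a letter.\<close>

lemma coord_cone_support:
  assumes "u \<in> coord_cone S" and "u $ i \<noteq> 0"
  shows "i \<in> S"
proof (rule ccontr)
  assume i: "i \<notin> S"
  obtain t where "u = (\<Sum>i\<in>S. t i *\<^sub>R axis i 1)" using assms(1) by (auto simp: coord_cone_def)
  then have "u $ i = 0" using i by (auto simp: axis_def intro!: sum.neutral)
  with assms(2) show False by simp
qed

lemma axis_in_coord_cone: "i \<in> S \<Longrightarrow> axis i 1 \<in> coord_cone S"
  unfolding coord_cone_def
  by (intro CollectI exI[of _ "\<lambda>j. if j = i then 1 else 0"]) (simp add: if_distrib[of "\<lambda>a. a *\<^sub>R _"] cong: if_cong)

theorem theorem3:
  fixes A :: "nat \<Rightarrow> real ^ 'n::finite ^ 'n" and p :: "nat \<Rightarrow> real" and m r :: nat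
    and \<Omega> :: "nat \<Rightarrow> 'n set"
  assumes p_pos: "\<forall>j\<in>{1..m}. p j > 0"
    and p_sum: "(\<Sum>j=1..m. p j) = 1"
    and nonneg: "\<forall>j\<in>{1..m}. \<forall>i l. A j $ i $ l \<ge> 0"
    and irreducible: "\<not> reducible_family m A"
    and no_zero_row: "\<forall>j\<in>{1..m}. \<forall>i. row i (A j) \<noteq> 0"
    and no_zero_column: "\<forall>j\<in>{1..m}. \<forall>i. column i (A j) \<noteq> 0"
    and r: "r \<ge> 2"
    and partition: "indexed_partition r \<Omega>"
    and permutation: "\<forall>j\<in>{1..m}. acts_as_permutation r \<Omega> (A j)"
    and positive_product:
      "\<exists>k\<ge>1. \<exists>ds\<in>words m k. positive_block_diagonal r \<Omega> (word_prod A ds)"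
  shows "\<forall>x v. (\<forall>i. x $ i > 0) \<and> (\<forall>i. v $ i > 0) \<longrightarrow>
      (\<forall>k\<ge>1. beta m p A k v \<le> lyapunov_exponent m p A
            \<and> lyapunov_exponent m p A \<le> alpha_tilde m p A r \<Omega> k x) \<and>
      (\<exists>C. \<forall>k\<ge>1. alpha_tilde m p A r \<Omega> k x - beta m p A k v \<le> C * inverse (real k))"
proof (intro allI impI, elim conjE)
  fix x v :: "real ^ 'n"
  assume x: "\<forall>i. x $ i > 0" and v: "\<forall>i. v $ i > 0"
  have disj: "n = l" if "i \<in> \<Omega> n" "i \<in> \<Omega> l" "n \<in> {1..r}" "l \<in> {1..r}" for i n l
    using partition that unfolding indexed_partition_def disjoint_family_on_def by blast
  have "\<exists>n. n \<in> {1..r} \<and> i \<in> \<Omega> n" for i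
    using partition unfolding indexed_partition_def by (metis UNIV_I UN_E)
  \<comment> \<open>\<open>bl\<close> chooses a block containing each index; disjointness makes the
    choice unique, so the sets \<open>\<Omega> n\<close> are exactly its fibres.\<close>
  then obtain bl where bl: "\<And>i. bl i \<in> {1..r}" "\<And>i. i \<in> \<Omega> (bl i)" by metis
  have bl_iff: "i \<in> \<Omega> n \<longleftrightarrow> bl i = n" if "n \<in> {1..r}" for i n
    using disj[OF bl(2) _ bl(1) that] bl(2) by blast
  then have \<Omega>_eq: "\<Omega> n = {i. bl i = n}" if "n \<in> {1..r}" for n using that by blast
  interpret block_permuting_family m p A r bl v x
  proof
    show "0 < p d" if "d \<in> {1..m}" for d using p_pos that by blast
    show "(\<Sum>d=1..m. p d) = 1" by (rule p_sum)
    show "semipositive (row i (A d))" if "d \<in> {1..m}" for i d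
      using nonneg no_zero_row that by (simp add: semipositive_def row_def)
    show "semipositive (column i (A d))" if "d \<in> {1..m}" for i d
      using nonneg no_zero_column that by (simp add: semipositive_def column_def)
    show "range bl = {1..r}"
    proof
      show "range bl \<subseteq> {1..r}" using bl(1) by blast
      show "{1..r} \<subseteq> range bl"
      proof
        fix n assume n: "n \<in> {1..r}"
        then obtain i where "i \<in> \<Omega> n" using partition unfolding indexed_partition_def by blast
        then have "bl i = n" using bl_iff[OF n] by simp
        then show "n \<in> range bl" by blast
      qed
    qed
    show "\<exists>\<sigma>. \<sigma> permutes {1..r} \<and> (\<forall>i c. A d $ i $ c \<noteq> 0 \<longrightarrow> bl i = \<sigma> (bl c))"
      if d: "d \<in> {1..m}" for d
    proof -
      obtain \<sigma> where \<sigma>: "\<sigma> permutes {1..r}"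
        and cone: "\<And>n. n \<in> {1..r} \<Longrightarrow> (*v) (A d) ` coord_cone (\<Omega> n) \<subseteq> coord_cone (\<Omega> (\<sigma> n))"
        using permutation d unfolding acts_as_permutation_def by metis
      have "bl i = \<sigma> (bl c)" if ne: "A d $ i $ c \<noteq> 0" for i c
      proof -
        have "A d *v axis c 1 \<in> coord_cone (\<Omega> (\<sigma> (bl c)))"
          using cone[OF bl(1)] axis_in_coord_cone[OF bl(2)] by blast
        moreover have "(A d *v axis c 1) $ i \<noteq> 0"
          using ne by (simp add: matrix_vector_mult_basis column_def)
        ultimately have "i \<in> \<Omega> (\<sigma> (bl c))" by (rule coord_cone_support)
        moreover have "\<sigma> (bl c) \<in> {1..r}" using \<sigma> bl(1) by (simp only: permutes_in_image)
        ultimately show ?thesis using bl_iff by blast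
      qed
      with \<sigma> show ?thesis by blast
    qed
    show "(c, s) \<in> {(c, s). \<exists>d\<in>{1..m}. A d $ s $ c \<noteq> 0}\<^sup>*" for c s
      by (rule irreducible_connected[OF irreducible])
    obtain q W where W: "W \<in> words m q" "positive_block_diagonal r \<Omega> (word_prod A W)"
      using positive_product by blast
    have "0 < word_prod A W $ i $ c" if "bl i = bl c" for i c
      using W(2) bl[of i] bl[of c] that unfolding positive_block_diagonal_def by metis
    with W(1) show "\<exists>q. \<exists>W\<in>words m q. \<forall>i c. bl i = bl c \<longrightarrow> 0 < word_prod A W $ i $ c" by blast
    show "0 < v $ i" "0 < x $ i" for i using v x by auto
  qed
  have alpha: "alpha_tilde m p A r \<Omega> k x = max_growth k / real k" for k
  proof -
    have "(\<lambda>j. expect m p A k (\<lambda>B. MAX i\<in>\<Omega> j. ln ((B *v x) $ i / x $ i))) ` {1..r} = block_growth k ` {1..r}"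
      by (rule image_cong) (simp_all add: \<Omega>_eq block_growth_def block_ratio_def[abs_def])
    then show ?thesis by (simp only: alpha_tilde_def max_growth_def) simp
  qed
  obtain C where
    "\<And>k. k \<ge> 1 \<Longrightarrow> beta m p A k v \<le> lyapunov_exponent m p A"
    "\<And>k. k \<ge> 1 \<Longrightarrow> lyapunov_exponent m p A \<le> max_growth k / real k"
    "\<And>k. k \<ge> 1 \<Longrightarrow> max_growth k / real k - beta m p A k v \<le> C * inverse (real k)"
    by (rule growth_bounds) blast
  then show "(\<forall>k\<ge>1. beta m p A k v \<le> lyapunov_exponent m p A
            \<and> lyapunov_exponent m p A \<le> alpha_tilde m p A r \<Omega> k x) \<and>
      (\<exists>C. \<forall>k\<ge>1. alpha_tilde m p A r \<Omega> k x - beta m p A k v \<le> C * inverse (real k))"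
    unfolding alpha by blast
qed

end
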